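(* Let $X$ be a uniformly convex Banach space, let $Y$ be a uniformly smooth Banach space, and let $\theta : S_X \times S_{Y^*} \to \mathbb{R}$ be a non-zero function such that: (a) $\theta$ is uniformly continuous on $S_X \times S_{Y^*}$; (b) $\theta(-x, y^* )=\theta(x,-y^* )=-\theta(x,y^* )$ for all $(x,y^* )\in S_X \times S_{Y^*}$; (c) $\Pi_\theta(X,Y):=\{ (x,y^* )\in S_X \times S_{Y^*}: \theta(x,y^* )=1\}$ is nonempty. Let $W$ be any Banach space and let $(\mathcal{Z}, \|\cdot\|_{\mathcal{Z}})$ be a Banach space included in $(C_{b,e}(\Pi_\theta(X,Y), W), \|\cdot\|_{\infty})$ and satisfying: (i) $\|\cdot\|_{\mathcal{Z}}\geq \|\cdot\|_{\infty}$ on $\mathcal{Z}$; (ii) $\mathcal{Z}$ contains $[\mathcal{F}(X,Y)]\oplus W$, and $\|[T]\oplus w\|_{\mathcal{Z}}\leq \|T\|\,\|w\|$ for all $(T,w)\in \mathcal{F}(X,Y)\times W$. Then, for every $\Theta \in C_{b,e}(\Pi_\theta (X,Y), W)$, the set $$\mathcal{G}(\Theta):=\{ \Phi \in \mathcal{Z}: \Theta+\Phi \text{ attains strongly its } \theta\text{-numerical radius} \}$$ is the complement of a $\sigma$-porous subset of $(\mathcal{Z}, \|\cdot\|_{\mathcal{Z}})$. Moreover, for every $\varepsilon >0$ there exists $\eta(\varepsilon)>0$ such that whenever $\Phi\in \mathcal{Z}$ with $v_\theta (\Phi)=1$ and $(x,y^* )\in \Pi_\theta (X,Y)$ satisfy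 $\|\Phi(x,y^* )\|>1-\eta(\varepsilon)$, there are $\Psi \in \mathcal{Z}$ with $v_\theta (\Psi)=1$ and $(z,t^* )\in \Pi_\theta (X,Y)$ such that $$\|\Psi(z,t^* )\|=1, \quad \|z-x\|+\|t^*-y^*\| < \varepsilon \quad\text{and}\quad v_\theta (\Psi-\Phi)<\varepsilon.$$
   Context: All Banach spaces are real and nonzero. $S_X$ is the unit sphere of $X$, $X^*$ its topological dual. $X\times Y^*$ carries the norm $\|(x,y^* )\|=\|x\|+\|y^*\|$; continuity and uniform continuity on subsets of $X\times Y^*$ refer to this norm. $C_{b,e}(\Pi_\theta (X,Y), W)$ is the Banach space of all bounded continuous functions $\Phi:\Pi_\theta (X,Y)\to W$ with $\Phi(x,y^* )=\Phi(-x,-y^* )$ for all $(x,y^* )\in \Pi_\theta (X,Y)$, with the sup-norm $\|\cdot\|_\infty$. "A Banach space included in" it means a linear subspace $\mathcal{Z}$ with its own complete norm $\|\cdot\|_{\mathcal{Z}}$. The $\theta$-numerical radius of $\Phi\in C_{b,e}(\Pi_\theta(X,Y),W)$ is $v_\theta(\Phi):=\sup \{ \|\Phi(x,y^* )\|: (x,y^* )\in \Pi_\theta (X,Y)\}=\|\Phi\|_\infty$. $\Phi$ attains strongly its $\theta$-numerical radius if there is $(x_0,y^*_0)\in \Pi_\theta(X,Y)$ such that $\|\Phi(x_0,y^*_0)\|=v_\theta(\Phi)$ and, whenever $(x_n, y^*_n)_n\subseteq \Pi_\theta(X,Y)$ with $\|\Phi(x_n,y^*_n)\|\to v_\theta (\Phi)$,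 one has $\min(\|x_n-x_0\|+\|y^*_n-y^*_0\|, \|x_n+x_0\|+\|y^*_n+y^*_0\|)\to 0$. $\mathcal{F}(X,Y)$ is the space of finite rank bounded linear operators from $X$ into $Y$, and $[\mathcal{F}(X,Y)]\oplus W:=\{ [T]\oplus w: T\in \mathcal{F}(X,Y), w\in W\}$, where $[T]\oplus w$ is the map $(x,y^* )\mapsto y^*(T(x))\,w$ from $X\times Y^*$ to $W$, regarded by restriction as a function on $\Pi_\theta(X,Y)$. A subset $A$ of a metric space $(M,d)$ is porous if there exist $\lambda_0\in(0,1]$ and $r_0>0$ such that for any $x\in M$ and $r\in(0,r_0]$ there is $y\in M$ with $\mathring{B}(y;\lambda_0 r)\subseteq \mathring{B}(x;r)\cap (M\setminus A)$, where $\mathring{B}(x;r)$ is the open ball of centre $x$ and radius $r$. $A$ is $\sigma$-porous if it is a countable union of porous sets. *)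

theory Defs
  imports "HOL-Analysis.Analysis"
begin

section \<open>Uniform convexity and uniform smoothness\<close>

definition uniformly_convex :: "'a::real_normed_vector itself \<Rightarrow> bool" where
  "uniformly_convex _ \<longleftrightarrow>
     (\<forall>\<epsilon>>0. \<exists>\<delta>>0. \<forall>x y::'a. norm x = 1 \<longrightarrow> norm y = 1 \<longrightarrow> norm (x - y) \<ge> \<epsilon> \<longrightarrow>
        norm ((x + y) /\<^sub>R 2) \<le> 1 - \<delta>)"

definition uniformly_smooth :: "'a::real_normed_vector itself \<Rightarrow> bool" where
  "uniformly_smooth _ \<longleftrightarrow>
     (\<forall>\<epsilon>>0. \<exists>\<delta>>0. \<forall>x y::'a. norm x = 1 \<longrightarrow> norm y \<le> \<delta> \<longrightarrow>
        norm (x + y) + norm (x - y) \<le> 2 + \<epsilon> * norm y)"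


section \<open>The sum norm on a product\<close>

text \<open>The library norm on a product type is the Euclidean one. It is equivalent to the sum norm,
  so the library notions of continuity and uniform continuity are those of the sum norm; the two
  lemmas below make this explicit.\<close>

definition sum_norm :: "'a::real_normed_vector \<times> 'b::real_normed_vector \<Rightarrow> real" where
  "sum_norm p = norm (fst p) + norm (snd p)"

lemma norm_le_sum_norm: "norm p \<le> sum_norm p"
  by (metis norm_Pair_le prod.collapse sum_norm_def)

lemma sum_norm_le_norm: "sum_norm p \<le> 2 * norm p"
  using norm_fst_le[of "fst p" "snd p"] norm_snd_le[of "snd p" "fst p"]
  by (simp add: sum_norm_def)

lemma continuous_on_sum_norm:
  fixes f :: "'a::real_normed_vector \<times> 'b::real_normed_vector \<Rightarrow> 'c::metric_space"
  shows "continuous_on S f \<longleftrightarrow>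
    (\<forall>p\<in>S. \<forall>\<epsilon>>0. \<exists>\<delta>>0. \<forall>q\<in>S. sum_norm (q - p) < \<delta> \<longrightarrow> dist (f q) (f p) < \<epsilon>)"
  (is "?L \<longleftrightarrow> ?R")
proof
  assume ?L
  then show ?R
    unfolding continuous_on_iff dist_norm[of "_ :: 'a \<times> 'b"]
    by (meson norm_le_sum_norm order_le_less_trans)
next
  assume R: ?R
  show ?L
    unfolding continuous_on_iff dist_norm[of "_ :: 'a \<times> 'b"]
  proof (intro ballI allI impI)
    fix p and \<epsilon> :: real assume "p \<in> S" "0 < \<epsilon>"
    then obtain \<delta> where d: "\<delta> > 0" "\<And>q. q \<in> S \<Longrightarrow> sum_norm (q - p) < \<delta> \<Longrightarrow> dist (f q) (f p) < \<epsilon>"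
      using R by blast
    have "dist (f q) (f p) < \<epsilon>" if "q \<in> S" "norm (q - p) < \<delta> / 2" for q
      using that d(2)[of q] sum_norm_le_norm[of "q - p"] by linarith
    then show "\<exists>\<delta>>0. \<forall>q\<in>S. norm (q - p) < \<delta> \<longrightarrow> dist (f q) (f p) < \<epsilon>"
      using d(1) by (intro exI[of _ "\<delta> / 2"]) auto
  qed
qed

lemma uniformly_continuous_on_sum_norm:
  fixes f :: "'a::real_normed_vector \<times> 'b::real_normed_vector \<Rightarrow> 'c::metric_space"
  shows "uniformly_continuous_on S f \<longleftrightarrow>
    (\<forall>\<epsilon>>0. \<exists>\<delta>>0. \<forall>p\<in>S. \<forall>q\<in>S. sum_norm (q - p) < \<delta> \<longrightarrow> dist (f q) (f p) < \<epsilon>)"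
  (is "?L \<longleftrightarrow> ?R")
proof
  assume ?L
  then show ?R
    unfolding uniformly_continuous_on_def dist_norm[of "_ :: 'a \<times> 'b"]
    by (meson norm_le_sum_norm order_le_less_trans)
next
  assume R: ?R
  show ?L
    unfolding uniformly_continuous_on_def dist_norm[of "_ :: 'a \<times> 'b"]
  proof (intro allI impI)
    fix \<epsilon> :: real assume "0 < \<epsilon>"
    then obtain \<delta> where d: "\<delta> > 0"
      "\<And>p q. p \<in> S \<Longrightarrow> q \<in> S \<Longrightarrow> sum_norm (q - p) < \<delta> \<Longrightarrow> dist (f q) (f p) < \<epsilon>"
      using R by blast
    have "dist (f q) (f p) < \<epsilon>" if "p \<in> S" "q \<in> S" "norm (q - p) < \<delta> / 2" for p q
      using that d(2)[of p q] sum_norm_le_norm[of "q - p"] by linarith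
    then show "\<exists>\<delta>>0. \<forall>p\<in>S. \<forall>q\<in>S. norm (q - p) < \<delta> \<longrightarrow> dist (f q) (f p) < \<epsilon>"
      using d(1) by (intro exI[of _ "\<delta> / 2"]) auto
  qed
qed


section \<open>The set \<open>\<Pi>\<close>, even functions on it, and the numerical radius\<close>

text \<open>The dual of \<open>Y\<close> is the type of bounded linear functions from \<open>Y\<close> to the reals, with the
  operator norm.\<close>

definition Pi_set ::
  "('x::real_normed_vector \<times> ('y::real_normed_vector \<Rightarrow>\<^sub>L real) \<Rightarrow> real) \<Rightarrow> ('x \<times> ('y \<Rightarrow>\<^sub>L real)) set"
  where "Pi_set \<theta> = {p \<in> sphere 0 1 \<times> sphere 0 1. \<theta> p = 1}"

text \<open>A function on \<open>Pi_set \<theta>\<close> is represented by its extension by zero, so that equality and the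
  pointwise linear operations of such functions are those of functions on \<open>Pi_set \<theta>\<close>.\<close>

definition Cbe ::
  "('x::real_normed_vector \<times> ('y::real_normed_vector \<Rightarrow>\<^sub>L real) \<Rightarrow> real) \<Rightarrow>
    ('x \<times> ('y \<Rightarrow>\<^sub>L real) \<Rightarrow> 'w::real_normed_vector) set"
  where "Cbe \<theta> = {\<Phi>. continuous_on (Pi_set \<theta>) \<Phi> \<and> bounded (\<Phi> ` Pi_set \<theta>) \<and>
     (\<forall>(x, y)\<in>Pi_set \<theta>. \<Phi> (x, y) = \<Phi> (- x, - y)) \<and> (\<forall>p. p \<notin> Pi_set \<theta> \<longrightarrow> \<Phi> p = 0)}"

text \<open>This is also the sup-norm of \<open>Cbe \<theta>\<close>.\<close>

definition num_radius ::
  "('x::real_normed_vector \<times> ('y::real_normed_vector \<Rightarrow>\<^sub>L real) \<Rightarrow> real) \<Rightarrow>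
    ('x \<times> ('y \<Rightarrow>\<^sub>L real) \<Rightarrow> 'w::real_normed_vector) \<Rightarrow> real"
  where "num_radius \<theta> \<Phi> = (SUP p\<in>Pi_set \<theta>. norm (\<Phi> p))"

definition attains_strongly ::
  "('x::real_normed_vector \<times> ('y::real_normed_vector \<Rightarrow>\<^sub>L real) \<Rightarrow> real) \<Rightarrow>
    ('x \<times> ('y \<Rightarrow>\<^sub>L real) \<Rightarrow> 'w::real_normed_vector) \<Rightarrow> bool"
  where "attains_strongly \<theta> \<Phi> \<longleftrightarrow>
    (\<exists>p\<^sub>0\<in>Pi_set \<theta>. norm (\<Phi> p\<^sub>0) = num_radius \<theta> \<Phi> \<and>
      (\<forall>s::nat \<Rightarrow> _. (\<forall>n. s n \<in> Pi_set \<theta>) \<longrightarrow> (\<lambda>n. norm (\<Phi> (s n))) \<longlonglongrightarrow> num_radius \<theta> \<Phi> \<longrightarrow>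
        (\<lambda>n. min (sum_norm (s n - p\<^sub>0)) (sum_norm (s n + p\<^sub>0))) \<longlonglongrightarrow> 0))"

definition finite_rank :: "('x::real_normed_vector \<Rightarrow>\<^sub>L 'y::real_normed_vector) \<Rightarrow> bool" where
  "finite_rank T \<longleftrightarrow> (\<exists>B. finite B \<and> range (blinfun_apply T) \<subseteq> span B)"

definition rank_fun ::
  "('x::real_normed_vector \<times> ('y::real_normed_vector \<Rightarrow>\<^sub>L real) \<Rightarrow> real) \<Rightarrow>
    ('x \<Rightarrow>\<^sub>L 'y) \<Rightarrow> 'w::real_normed_vector \<Rightarrow> 'x \<times> ('y \<Rightarrow>\<^sub>L real) \<Rightarrow> 'w"
  where "rank_fun \<theta> T w =
    (\<lambda>(x, y). if (x, y) \<in> Pi_set \<theta> then blinfun_apply y (blinfun_apply T x) *\<^sub>R w else 0)"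


section \<open>Banach spaces of functions\<close>

text \<open>Linear subspaces \<open>Z\<close> of a function space carrying their own norm \<open>N\<close>, of which only the
  values on \<open>Z\<close> matter.\<close>

definition normed_function_space ::
  "('a \<Rightarrow> 'w::real_vector) set \<Rightarrow> (('a \<Rightarrow> 'w) \<Rightarrow> real) \<Rightarrow> bool" where
  "normed_function_space Z N \<longleftrightarrow>
     (\<lambda>_. 0) \<in> Z \<and>
     (\<forall>f\<in>Z. \<forall>g\<in>Z. (\<lambda>p. f p + g p) \<in> Z) \<and>
     (\<forall>c. \<forall>f\<in>Z. (\<lambda>p. c *\<^sub>R f p) \<in> Z) \<and>
     (\<forall>f\<in>Z. 0 \<le> N f) \<and>
     (\<forall>f\<in>Z. N f = 0 \<longleftrightarrow> f = (\<lambda>_. 0)) \<and>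
     (\<forall>c. \<forall>f\<in>Z. N (\<lambda>p. c *\<^sub>R f p) = \<bar>c\<bar> * N f) \<and>
     (\<forall>f\<in>Z. \<forall>g\<in>Z. N (\<lambda>p. f p + g p) \<le> N f + N g)"

text \<open>The metric induced by \<open>N\<close> on \<open>Z\<close>. The value outside \<open>Z\<close> is irrelevant, but the library
  requires a distance function to be symmetric and nonnegative there as well.\<close>

definition norm_metric ::
  "('a \<Rightarrow> 'w::real_vector) set \<Rightarrow> (('a \<Rightarrow> 'w) \<Rightarrow> real) \<Rightarrow> ('a \<Rightarrow> 'w) metric" where
  "norm_metric Z N =
     metric (Z, \<lambda>f g. if f \<in> Z \<and> g \<in> Z then N (\<lambda>p. f p - g p) else 0)"

lemma
  assumes "normed_function_space Z N"
  shows mspace_norm_metric: "mspace (norm_metric Z N) = Z"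
    and mdist_norm_metric:
      "\<And>f g. f \<in> Z \<Longrightarrow> g \<in> Z \<Longrightarrow> mdist (norm_metric Z N) f g = N (\<lambda>p. f p - g p)"
proof -
  let ?d = "\<lambda>f g. if f \<in> Z \<and> g \<in> Z then N (\<lambda>p. f p - g p) else 0"
  have add: "f \<in> Z \<Longrightarrow> g \<in> Z \<Longrightarrow> (\<lambda>p. f p + g p) \<in> Z"
    and scale: "f \<in> Z \<Longrightarrow> (\<lambda>p. c *\<^sub>R f p) \<in> Z"
    and nonneg: "f \<in> Z \<Longrightarrow> 0 \<le> N f"
    and zero: "f \<in> Z \<Longrightarrow> N f = 0 \<longleftrightarrow> f = (\<lambda>_. 0)"
    and homog: "f \<in> Z \<Longrightarrow> N (\<lambda>p. c *\<^sub>R f p) = \<bar>c\<bar> * N f"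
    and tri: "f \<in> Z \<Longrightarrow> g \<in> Z \<Longrightarrow> N (\<lambda>p. f p + g p) \<le> N f + N g" for f g c
    using assms unfolding normed_function_space_def by blast+
  have diff: "(\<lambda>p. f p - g p) \<in> Z" if "f \<in> Z" "g \<in> Z" for f g
    using add[OF that(1) scale[OF that(2), of "-1"]] by simp
  interpret Metric_space Z ?d
  proof
    show "0 \<le> ?d f g" for f g
      using nonneg diff by auto
    show "?d f g = ?d g f" for f g
      using homog[OF diff, of g f "-1"] by auto
    show "?d f g = 0 \<longleftrightarrow> f = g" if "f \<in> Z" "g \<in> Z" for f g
      using that zero[OF diff[OF that]] by (auto simp: fun_eq_iff)
    show "?d f h \<le> ?d f g + ?d g h" if "f \<in> Z" "g \<in> Z" "h \<in> Z" for f g h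
      using that tri[OF diff[of f g] diff[of g h]] by simp
  qed
  show "mspace (norm_metric Z N) = Z"
    by (simp add: norm_metric_def)
  show "\<And>f g. f \<in> Z \<Longrightarrow> g \<in> Z \<Longrightarrow> mdist (norm_metric Z N) f g = N (\<lambda>p. f p - g p)"
    by (simp add: norm_metric_def)
qed

definition banach_function_space ::
  "('a \<Rightarrow> 'w::real_vector) set \<Rightarrow> (('a \<Rightarrow> 'w) \<Rightarrow> real) \<Rightarrow> bool" where
  "banach_function_space Z N \<longleftrightarrow> normed_function_space Z N \<and> mcomplete_of (norm_metric Z N)"


section \<open>Porosity\<close>

definition porous_in :: "'a metric \<Rightarrow> 'a set \<Rightarrow> bool" where
  "porous_in m A \<longleftrightarrow> A \<subseteq> mspace m \<and>
     (\<exists>c r\<^sub>0. 0 < c \<and> c \<le> 1 \<and> 0 < r\<^sub>0 \<and>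
       (\<forall>x\<in>mspace m. \<forall>r. 0 < r \<and> r \<le> r\<^sub>0 \<longrightarrow>
         (\<exists>y\<in>mspace m. mball_of m y (c * r) \<subseteq> mball_of m x r \<inter> (mspace m - A))))"

definition sigma_porous_in :: "'a metric \<Rightarrow> 'a set \<Rightarrow> bool" where
  "sigma_porous_in m A \<longleftrightarrow> (\<exists>\<A>. countable \<A> \<and> (\<forall>B\<in>\<A>. porous_in m B) \<and> A = \<Union>\<A>)"

end

theory Submission
  imports Defs
begin

text \<open>
  The bilinear forms \<open>(z, t) \<mapsto> t (T z)\<close> with \<open>T\<close> of rank one already contain, for every point
  \<open>(x, y)\<close> of \<open>Pi_set \<theta>\<close>, one of norm at most 1 that peaks at \<open>(x, y)\<close> and \<open>- (x, y)\<close>, uniformly in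
  the point: where its absolute value exceeds \<open>1 - \<delta>\<close>, the argument is close to one of these two
  points (\<open>rank_one_peak\<close>). Here \<open>T z = f z *\<^sub>R u\<close> with \<open>f\<close> norming \<open>x\<close> and \<open>u\<close> almost norming \<open>y\<close>.
  Uniform convexity controls the first factor, uniform smoothness the second. They leave four
  possible combinations of signs, and \<open>\<theta>\<close> rules out \<open>(- x, y)\<close> and \<open>(x, - y)\<close>, where it equals
  \<open>- 1\<close>.

  Adding a small multiple of such a peak, centred at a point \<open>p\<close> where a bounded function \<open>F\<close> almost
  attains its supremum and pointing in the direction \<open>F p\<close>, forces all near-maximisers of the new
  function to lie close to \<open>p\<close> or \<open>- p\<close>. This survives further perturbations whose size is a fixed
  fraction of the first one (\<open>localising_perturbation\<close>). So for each \<open>\<epsilon>\<close> the functions whose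
  near-maximisers do not concentrate, up to sign, in an \<open>\<epsilon>\<close>-ball form a porous set
  (\<open>porous_not_localised\<close>). If they concentrate for every \<open>\<epsilon>\<close>, completeness of \<open>X\<close> and of the
  dual of \<open>Y\<close> yields a strong maximiser (\<open>attains_strongly_if_localised\<close>). This gives
  \<open>\<sigma>\<close>-porosity.

  For the second part, by the Baire category theorem the strongly attaining functions are dense.
  Apply the localising perturbation at the given point, approximate the result by a function that
  attains, and rescale it to numerical radius 1: its maximisers are near-maximisers, hence close to
  the given point up to sign, and the functions are even (\<open>bishop_phelps_bollobas\<close>).
\<close>

section \<open>Norming functionals\<close>

definition sublinear :: "('a::real_vector \<Rightarrow> real) \<Rightarrow> bool" where
  "sublinear p \<longleftrightarrow> (\<forall>x y. p (x + y) \<le> p x + p y) \<and> (\<forall>c>0. \<forall>x. p (c *\<^sub>R x) = c * p x)"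

lemma sublinearI:
  assumes "\<And>x y. p (x + y) \<le> p x + p y" "\<And>c x. 0 < c \<Longrightarrow> p (c *\<^sub>R x) \<le> c * p x"
  shows "sublinear p"
proof -
  have "c * p x \<le> p (c *\<^sub>R x)" if "0 < c" for c x
    using assms(2)[of "inverse c" "c *\<^sub>R x"] that by (simp add: field_simps)
  with assms show ?thesis
    unfolding sublinear_def by (meson antisym)
qed

lemma
  assumes "sublinear p"
  shows sublinear_add: "p (x + y) \<le> p x + p y"
    and sublinear_scaleR: "0 < c \<Longrightarrow> p (c *\<^sub>R x) = c * p x"
    and sublinear_zero: "p 0 = 0"
    and sublinear_minus: "- p (- x) \<le> p x"
proof -
  show *: "p (x + y) \<le> p x + p y" and "0 < c \<Longrightarrow> p (c *\<^sub>R x) = c * p x" for x y c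
    using assms by (auto simp: sublinear_def)
  have "p (2 *\<^sub>R 0) = 2 * p 0"
    using assms unfolding sublinear_def by (meson zero_less_numeral)
  then show "p 0 = 0" by simp
  then show "- p (- x) \<le> p x"
    using *[of x "- x"] by simp
qed

lemma sublinear_norm: "sublinear norm"
  by (auto simp: sublinear_def norm_triangle_ineq)

text \<open>Lowering \<open>p\<close> as far as possible in the direction \<open>- x\<close>: this is the largest sublinear
  function below \<open>p\<close> whose value at \<open>- x\<close> is at most \<open>- p x\<close>.\<close>

definition lowered :: "('a::real_vector \<Rightarrow> real) \<Rightarrow> 'a \<Rightarrow> 'a \<Rightarrow> real" where
  "lowered p x z = (INF t\<in>{0..}. p (z + t *\<^sub>R x) - t * p x)"

lemma
  assumes p: "sublinear p"
  shows sublinear_lowered: "sublinear (lowered p x)"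
    and lowered_le: "lowered p x z \<le> p z"
    and lowered_minus_le: "lowered p x (- x) \<le> - p x"
proof -
  have lb: "- p (- z) \<le> p (z + t *\<^sub>R x) - t * p x" if "0 \<le> t" for z t
  proof -
    have "p (t *\<^sub>R x) = t * p x"
      using that p sublinear_scaleR[of p t x] sublinear_zero[of p] by (cases "t = 0") auto
    then show ?thesis
      using sublinear_add[OF p, of "z + t *\<^sub>R x" "- z"] by simp
  qed
  have bdd: "bdd_below ((\<lambda>t. p (z + t *\<^sub>R x) - t * p x) ` {0..})" for z
    using lb by (auto intro!: bdd_belowI2)
  have low: "lowered p x z \<le> p (z + t *\<^sub>R x) - t * p x" if "0 \<le> t" for z t
    unfolding lowered_def using that by (intro cINF_lower bdd) auto
  have great: "a \<le> lowered p x z" if "\<And>t. 0 \<le> t \<Longrightarrow> a \<le> p (z + t *\<^sub>R x) - t * p x" for a z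
    unfolding lowered_def using that by (intro cINF_greatest) auto
  show "lowered p x z \<le> p z" for z
    using low[of 0 z] by simp
  show "lowered p x (- x) \<le> - p x"
    using low[of 1 "- x"] sublinear_zero[OF p] by simp
  show "sublinear (lowered p x)"
  proof (rule sublinearI)
    fix y z
    have "lowered p x (y + z) - (p (z + s *\<^sub>R x) - s * p x) \<le> p (y + t *\<^sub>R x) - t * p x"
      if "0 \<le> s" "0 \<le> t" for s t
    proof -
      have "y + z + (t + s) *\<^sub>R x = (y + t *\<^sub>R x) + (z + s *\<^sub>R x)"
        by (simp add: algebra_simps)
      then show ?thesis
        using low[of "t + s" "y + z"] that
          sublinear_add[OF p, of "y + t *\<^sub>R x" "z + s *\<^sub>R x"]
        by (simp add: algebra_simps)
    qed
    then have "lowered p x (y + z) - (p (z + s *\<^sub>R x) - s * p x) \<le> lowered p x y"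
      if "0 \<le> s" for s
      using great that by blast
    then have "lowered p x (y + z) - lowered p x y \<le> lowered p x z"
      using great[of "lowered p x (y + z) - lowered p x y" z] by (simp add: algebra_simps)
    then show "lowered p x (y + z) \<le> lowered p x y + lowered p x z" by simp
  next
    fix c :: real and z assume c: "0 < c"
    have "lowered p x (c *\<^sub>R z) / c \<le> p (z + t *\<^sub>R x) - t * p x" if "0 \<le> t" for t
      using low[of "c * t" "c *\<^sub>R z"] that c sublinear_scaleR[OF p c, of "z + t *\<^sub>R x"]
      by (simp add: field_simps)
    then have "lowered p x (c *\<^sub>R z) / c \<le> lowered p x z"
      by (rule great)
    then show "lowered p x (c *\<^sub>R z) \<le> c * lowered p x z"
      using c by (simp add: field_simps)
  qed
qed

text \<open>The infimum of a chain is subadditive because any two members of the chain are dominated from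
  below by one of them; it is finite because every sublinear \<open>q \<le> p\<close> satisfies
  \<open>q z \<ge> - q (- z) \<ge> - p (- z)\<close>.\<close>

lemma minimal_sublinear_exists:
  fixes p :: "'a::real_vector \<Rightarrow> real"
  assumes p: "sublinear p"
  obtains m where "sublinear m" "m \<le> p" "\<And>q. sublinear q \<Longrightarrow> q \<le> m \<Longrightarrow> q = m"
proof -
  define A where "A = {q. sublinear q \<and> q \<le> p}"
  have lb: "- p (- z) \<le> q z" if "q \<in> A" for q z
    using that sublinear_minus[of q z] le_funD[of q p "- z"] by (auto simp: A_def)
  have "\<exists>m\<in>A. \<forall>q\<in>A. q \<le> m \<longrightarrow> q = m"
  proof (rule predicate_Zorn)
    show "partial_order_on A (relation_of (\<lambda>a b. b \<le> a) A)"
      by (rule partial_order_on_relation_ofI) auto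
  next
    fix C assume C: "C \<in> Chains (relation_of (\<lambda>a b. b \<le> a) A)"
    have CA: "C \<subseteq> A" and chain: "\<And>q q'. q \<in> C \<Longrightarrow> q' \<in> C \<Longrightarrow> q \<le> q' \<or> q' \<le> q"
      using C by (auto simp: Chains_def relation_of_def)
    show "\<exists>u\<in>A. \<forall>a\<in>C. u \<le> a"
    proof (cases "C = {}")
      case True
      then show ?thesis using p by (auto simp: A_def)
    next
      case False
      define u where "u = (\<lambda>z. INF q\<in>C. q z)"
      have low: "u z \<le> q z" if "q \<in> C" for q z
        unfolding u_def using that lb CA by (intro cINF_lower bdd_belowI2[of _ "- p (- z)"]) auto
      have great: "a \<le> u z" if "\<And>q. q \<in> C \<Longrightarrow> a \<le> q z" for a z
        unfolding u_def using False that by (intro cINF_greatest) auto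
      have "sublinear u"
      proof (rule sublinearI)
        fix y z
        have "u (y + z) - q z \<le> q' y" if q: "q \<in> C" "q' \<in> C" for q q'
        proof -
          obtain m where m: "m \<in> C" "m \<le> q" "m \<le> q'"
            using chain[OF q] q by blast
          have "u (y + z) \<le> m (y + z)"
            using low m by blast
          also have "\<dots> \<le> m y + m z"
            using m CA by (intro sublinear_add) (auto simp: A_def)
          also have "\<dots> \<le> q' y + q z"
            using m by (intro add_mono) (auto dest: le_funD)
          finally show ?thesis by simp
        qed
        then have "u (y + z) - q z \<le> u y" if "q \<in> C" for q
          using great that by blast
        then have "u (y + z) - u y \<le> u z"
          using great[of "u (y + z) - u y" z] by (simp add: algebra_simps)
        then show "u (y + z) \<le> u y + u z" by simp
      next
        fix c :: real and z assume c: "0 < c"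
        have "u (c *\<^sub>R z) / c \<le> q z" if "q \<in> C" for q
          using low[OF that, of "c *\<^sub>R z"] c CA that sublinear_scaleR[of q c z]
          by (auto simp: A_def field_simps)
        then have "u (c *\<^sub>R z) / c \<le> u z"
          by (rule great)
        then show "u (c *\<^sub>R z) \<le> c * u z"
          using c by (simp add: field_simps)
      qed
      moreover have "u \<le> p"
      proof -
        obtain q where "q \<in> C" using False by blast
        then have "u \<le> q" "q \<le> p"
          using low CA by (auto simp: le_fun_def A_def)
        then show ?thesis by (rule order_trans)
      qed
      ultimately show ?thesis
        using low by (intro bexI[of _ u]) (auto simp: A_def le_fun_def)
    qed
  qed
  then obtain m where "m \<in> A" "\<And>q. q \<in> A \<Longrightarrow> q \<le> m \<Longrightarrow> q = m"
    by blast
  then show ?thesis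
    using that[of m] by (auto simp: A_def intro: order_trans)
qed

text \<open>A minimal sublinear function cannot be lowered any more, so it is odd; an odd sublinear
  function is additive.\<close>

lemma minimal_sublinear_linear:
  assumes m: "sublinear m" and minimal: "\<And>q. sublinear q \<Longrightarrow> q \<le> m \<Longrightarrow> q = m"
  shows "linear m"
proof -
  have "m (- x) \<le> - m x" for x
    using minimal[OF sublinear_lowered[OF m, of x]] lowered_le[OF m, of x] lowered_minus_le[OF m, of x]
    by (auto simp: le_fun_def)
  then have odd: "m (- x) = - m x" for x
    using sublinear_minus[OF m, of x] by (smt (verit))
  show ?thesis
  proof (rule linearI)
    show "m (x + y) = m x + m y" for x y
      using sublinear_add[OF m, of x y] sublinear_add[OF m, of "x + y" "- y"] odd[of y] by simp
    show "m (c *\<^sub>R x) = c *\<^sub>R m x" for c x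
    proof -
      consider "c > 0" | "c = 0" | "- c > 0" by linarith
      then show ?thesis
        using sublinear_scaleR[OF m, of c x] sublinear_scaleR[OF m, of "- c" x]
          sublinear_zero[OF m] odd[of "c *\<^sub>R x"]
        by cases auto
    qed
  qed
qed

text \<open>The Hahn-Banach theorem in the form needed here. A minimal sublinear function below the norm
  lowered along \<open>x\<close> is linear, and it is at most \<open>- norm x\<close> at \<open>- x\<close>.\<close>

lemma norming_functional:
  fixes x :: "'a::real_normed_vector"
  obtains f :: "'a \<Rightarrow>\<^sub>L real" where "norm f \<le> 1" "f x = norm x"
proof -
  obtain m where m: "sublinear m" "m \<le> lowered norm x" "linear m"
    using minimal_sublinear_exists[OF sublinear_lowered[OF sublinear_norm, of x]]
      minimal_sublinear_linear by metis
  have le: "m z \<le> norm z" for z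
    using le_funD[OF m(2), of z] lowered_le[OF sublinear_norm, of x z] by linarith
  have abs_le: "\<bar>m z\<bar> \<le> norm z" for z
    using le[of z] le[of "- z"] linear_neg[OF m(3), of z] by simp
  then have bl: "bounded_linear m"
    using m(3) by (intro bounded_linear_intro[where K = 1])
      (auto simp: linear_add linear_cmul)
  have "m x \<ge> norm x"
    using le_funD[OF m(2), of "- x"] lowered_minus_le[OF sublinear_norm, of x]
      linear_neg[OF m(3), of x] by simp
  with le[of x] have "m x = norm x" by simp
  moreover have "norm (Blinfun m) \<le> 1"
    using abs_le by (intro norm_blinfun_bound) (auto simp: bounded_linear_Blinfun_apply[OF bl])
  ultimately show ?thesis
    using that[of "Blinfun m"] by (simp add: bounded_linear_Blinfun_apply[OF bl])
qed


section \<open>Rank-one peaks on \<open>Pi_set \<theta>\<close>\<close>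

text \<open>If \<open>f\<close> is almost 1 at both \<open>x\<close> and \<open>z\<close>, it is so at their midpoint, whose norm is therefore
  almost 1.\<close>

lemma uniformly_convex_peak:
  assumes "uniformly_convex TYPE('x::real_normed_vector)" and "0 < \<epsilon>"
  obtains \<delta> where "0 < \<delta>" "\<And>(f :: 'x \<Rightarrow>\<^sub>L real) x z. \<lbrakk>norm f \<le> 1; norm x = 1; norm z = 1; blinfun_apply f x = 1; blinfun_apply f z > 1 - \<delta>\<rbrakk>
    \<Longrightarrow> norm (z - x) < \<epsilon>"
proof -
  obtain d where d: "d > 0" and
    *: "\<And>x y::'x. norm x = 1 \<Longrightarrow> norm y = 1 \<Longrightarrow> norm (x - y) \<ge> \<epsilon> \<Longrightarrow> norm ((x + y) /\<^sub>R 2) \<le> 1 - d"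
    using assms unfolding uniformly_convex_def by meson
  have "norm (z - x) < \<epsilon>"
    if "norm f \<le> 1" "norm x = 1" "norm z = 1" "blinfun_apply f x = 1" "blinfun_apply f z > 1 - 2 * d" for f :: "'x \<Rightarrow>\<^sub>L real" and x z
  proof (rule ccontr)
    assume "\<not> norm (z - x) < \<epsilon>"
    then have "norm ((z + x) /\<^sub>R 2) \<le> 1 - d"
      using *[of z x] that by simp
    moreover have "norm (f ((z + x) /\<^sub>R 2)) \<le> 1 * norm ((z + x) /\<^sub>R 2)"
      using norm_blinfun[of f] that(1) by (meson mult_right_mono norm_ge_zero order_trans)
    moreover have "f ((z + x) /\<^sub>R 2) = (f z + f x) / 2"
      by (simp add: blinfun.bilinear_simps)
    ultimately show False
      using that(4,5) by (simp add: abs_le_iff)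
  qed
  then show ?thesis
    using that[of "2 * d"] d by simp
qed

text \<open>Uniform smoothness of a space makes its dual uniformly convex; only slices cut out by a vector
  of the space are needed. If \<open>y\<close> and \<open>t\<close> almost attain their norm at \<open>u\<close>, then
  \<open>(t - y) v = t (u + v) + y (u - v) - t u - y u\<close> is at most
  \<open>norm (u + v) + norm (u - v) - 2\<close> up to a small error.\<close>

lemma uniformly_smooth_peak:
  assumes "uniformly_smooth TYPE('y::real_normed_vector)" and "0 < \<epsilon>"
  obtains \<delta> where "0 < \<delta>" "\<And>(y :: 'y \<Rightarrow>\<^sub>L real) t u. \<lbrakk>norm y \<le> 1; norm t \<le> 1; norm u = 1;
      blinfun_apply y u > 1 - \<delta>; blinfun_apply t u > 1 - \<delta>\<rbrakk> \<Longrightarrow> norm (t - y) < \<epsilon>"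
proof -
  obtain d where d: "d > 0" and
    *: "\<And>x y::'y. norm x = 1 \<Longrightarrow> norm y \<le> d \<Longrightarrow> norm (x + y) + norm (x - y) \<le> 2 + \<epsilon> / 4 * norm y"
    using assms unfolding uniformly_smooth_def by (metis zero_less_divide_iff zero_less_numeral)
  define \<delta> where "\<delta> = \<epsilon> * d / 8"
  have "norm (t - y) < \<epsilon>"
    if y: "norm y \<le> 1" "blinfun_apply y u > 1 - \<delta>" and t: "norm t \<le> 1" "blinfun_apply t u > 1 - \<delta>" and u: "norm u = 1"
    for y t :: "'y \<Rightarrow>\<^sub>L real" and u
  proof -
    have contr: "blinfun_apply f v \<le> norm v" if "norm f \<le> 1" for f :: "'y \<Rightarrow>\<^sub>L real" and v
      using norm_blinfun[of f v] mult_right_mono[OF that norm_ge_zero[of v]] by simp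
    have small: "(t - y) v \<le> \<epsilon> / 2 * d" if v: "norm v = d" for v
    proof -
      have "(t - y) v = t (u + v) + y (u - v) - t u - y u"
        by (simp add: blinfun.bilinear_simps)
      also have "\<dots> \<le> norm (u + v) + norm (u - v) - t u - y u"
        using contr[OF t(1)] contr[OF y(1)] by (intro diff_right_mono add_mono)
      also have "\<dots> \<le> 2 + \<epsilon> / 4 * d - (1 - \<delta>) - (1 - \<delta>)"
        using *[OF u, of v] v y(2) t(2) by simp
      finally show ?thesis by (simp add: \<delta>_def)
    qed
    have "norm (t - y) \<le> \<epsilon> / 2"
    proof (rule norm_blinfun_bound)
      fix v
      have "(t - y) v \<le> \<epsilon> / 2 * norm v" for v
      proof (cases "v = 0")
        case False
        then show ?thesis
          using small[of "(d / norm v) *\<^sub>R v"] d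
          by (simp add: blinfun.scaleR_right field_simps)
      qed (simp add: blinfun.zero_right)
      from this[of v] this[of "- v"] show "norm ((t - y) v) \<le> \<epsilon> / 2 * norm v"
        by (simp add: blinfun.minus_right abs_le_iff)
    qed (use assms in simp)
    then show ?thesis using \<open>0 < \<epsilon>\<close> by linarith
  qed
  moreover have "\<delta> > 0"
    using d \<open>0 < \<epsilon>\<close> by (simp add: \<delta>_def)
  ultimately show ?thesis using that by blast
qed

lemma almost_norm_attained:
  fixes y :: "'y::real_normed_vector \<Rightarrow>\<^sub>L real"
  assumes "a < norm y" "0 \<le> a"
  obtains u where "norm u = 1" "a < y u"
proof -
  have "\<exists>u. norm u = 1 \<and> a < y u"
  proof (rule ccontr)
    assume neg: "\<nexists>u. norm u = 1 \<and> a < y u"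
    have "norm y \<le> a"
    proof (rule norm_blinfun_bound)
      fix v
      have "y v \<le> a * norm v" for v
      proof (cases "v = 0")
        case False
        then have "y (v /\<^sub>R norm v) \<le> a"
          using neg by (auto simp: not_less)
        with False show ?thesis
          by (simp add: blinfun.scaleR_right field_simps)
      qed (simp add: blinfun.zero_right)
      from this[of v] this[of "- v"] show "norm (y v) \<le> a * norm v"
        by (simp add: blinfun.minus_right abs_le_iff)
    qed fact
    with assms show False by simp
  qed
  with that show ?thesis by blast
qed

text \<open>The distance modulo sign, in which strong attainment is phrased; it is a pseudometric.\<close>

definition pm_dist :: "'a::real_normed_vector \<times> 'b::real_normed_vector \<Rightarrow> 'a \<times> 'b \<Rightarrow> real" where
  "pm_dist p q = min (sum_norm (p - q)) (sum_norm (p + q))"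

lemma sum_norm_triangle: "sum_norm (p + q) \<le> sum_norm p + sum_norm q"
  using norm_triangle_ineq[of "fst p" "fst q"] norm_triangle_ineq[of "snd p" "snd q"]
  by (simp add: sum_norm_def)

lemma sum_norm_minus: "sum_norm (- p) = sum_norm p"
  by (simp add: sum_norm_def)

lemma pm_dist_commute: "pm_dist p q = pm_dist q p"
  unfolding pm_dist_def using sum_norm_minus[of "p - q"] by (simp add: add.commute)

lemma pm_dist_triangle: "pm_dist p r \<le> pm_dist p q + pm_dist q r"
proof -
  have "sum_norm (p - r) \<le> sum_norm (p - q) + sum_norm (q - r)"
    using sum_norm_triangle[of "p - q" "q - r"] by simp
  moreover have "sum_norm (p - r) \<le> sum_norm (p + q) + sum_norm (q + r)"
    using sum_norm_triangle[of "p + q" "- (q + r)"] sum_norm_minus[of "q + r"] by simp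
  moreover have "sum_norm (p + r) \<le> sum_norm (p - q) + sum_norm (q + r)"
    using sum_norm_triangle[of "p - q" "q + r"] by simp
  moreover have "sum_norm (p + r) \<le> sum_norm (p + q) + sum_norm (q - r)"
    using sum_norm_triangle[of "p + q" "- (q - r)"] sum_norm_minus[of "q - r"] by simp
  ultimately show ?thesis
    unfolding pm_dist_def by linarith
qed

locale odd_theta =
  fixes \<theta> :: "'x::real_normed_vector \<times> ('y::real_normed_vector \<Rightarrow>\<^sub>L real) \<Rightarrow> real"
  assumes theta_uc: "uniformly_continuous_on (sphere 0 1 \<times> sphere 0 1) \<theta>"
    and theta_odd: "\<And>x y. x \<in> sphere 0 1 \<Longrightarrow> y \<in> sphere 0 1 \<Longrightarrow>
          \<theta> (- x, y) = - \<theta> (x, y) \<and> \<theta> (x, - y) = - \<theta> (x, y)"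
    and Pi_nonempty: "Pi_set \<theta> \<noteq> {}"
begin

lemma Pi_minus: "p \<in> Pi_set \<theta> \<Longrightarrow> - p \<in> Pi_set \<theta>"
  using theta_odd[of "fst p" "snd p"] theta_odd[of "fst p" "- snd p"]
  by (cases p) (auto simp: Pi_set_def)

lemma closed_Pi: "closed (Pi_set \<theta>)"
proof -
  have "continuous_on (sphere 0 1 \<times> sphere 0 1) \<theta>"
    by (rule uniformly_continuous_imp_continuous[OF theta_uc])
  then have "closed ((sphere 0 1 \<times> sphere 0 1) \<inter> \<theta> -` {1})"
    unfolding sphere_def
    by (intro continuous_closed_preimage closed_Times closed_Collect_eq closed_singleton
        continuous_intros)
  moreover have "Pi_set \<theta> = (sphere 0 1 \<times> sphere 0 1) \<inter> \<theta> -` {1}"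
    by (auto simp: Pi_set_def)
  ultimately show ?thesis by simp
qed

lemma sum_norm_Pi: "p \<in> Pi_set \<theta> \<Longrightarrow> sum_norm p = 2"
  by (auto simp: Pi_set_def sum_norm_def)

text \<open>Oddness in each variable puts \<open>(- x, y)\<close> and \<open>(x, - y)\<close> on the level \<open>- 1\<close> of \<open>\<theta>\<close>, which
  uniform continuity keeps at a positive distance from the level \<open>1\<close>. So when both components of
  a point of \<open>Pi_set \<theta>\<close> agree up to sign with those of another one, the two signs are the same.\<close>

lemma signs_agree:
  assumes "0 < \<epsilon>"
  obtains \<rho> where "0 < \<rho>"
    "\<And>x y z t. \<lbrakk>(x, y) \<in> Pi_set \<theta>; (z, t) \<in> Pi_set \<theta>;
      norm (z - x) < \<rho> \<or> norm (z + x) < \<rho>; norm (t - y) < \<rho> \<or> norm (t + y) < \<rho>\<rbrakk>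
      \<Longrightarrow> pm_dist (z, t) (x, y) < \<epsilon>"
proof -
  have "\<exists>\<delta>>0. \<forall>p\<in>sphere 0 1 \<times> sphere 0 1. \<forall>q\<in>sphere 0 1 \<times> sphere 0 1.
      sum_norm (q - p) < \<delta> \<longrightarrow> dist (\<theta> q) (\<theta> p) < 2"
    using theta_uc unfolding uniformly_continuous_on_sum_norm by simp
  then obtain d where d: "d > 0" and
    *: "\<And>p q. \<lbrakk>p \<in> sphere 0 1 \<times> sphere 0 1; q \<in> sphere 0 1 \<times> sphere 0 1; sum_norm (q - p) < d\<rbrakk>
      \<Longrightarrow> dist (\<theta> q) (\<theta> p) < 2"
    by blast
  define \<rho> where "\<rho> = min d \<epsilon> / 2"
  have "pm_dist (z, t) (x, y) < \<epsilon>"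
    if xy: "(x, y) \<in> Pi_set \<theta>" and zt: "(z, t) \<in> Pi_set \<theta>"
      and z: "norm (z - x) < \<rho> \<or> norm (z + x) < \<rho>" and t: "norm (t - y) < \<rho> \<or> norm (t + y) < \<rho>"
    for x y z t
  proof -
    have sph: "x \<in> sphere 0 1" "y \<in> sphere 0 1" "z \<in> sphere 0 1" "t \<in> sphere 0 1"
      and one: "\<theta> (x, y) = 1" "\<theta> (z, t) = 1"
      using xy zt by (auto simp: Pi_set_def)
    have "\<theta> (- x, y) = - 1" "\<theta> (x, - y) = - 1"
      using theta_odd[OF sph(1,2)] one by auto
    then have "sum_norm ((z, t) - (- x, y)) \<ge> d" "sum_norm ((z, t) - (x, - y)) \<ge> d"
      using *[of "(- x, y)" "(z, t)"] *[of "(x, - y)" "(z, t)"] sph one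
      by (auto simp: dist_real_def not_less[symmetric])
    then have sep: "norm (z + x) + norm (t - y) \<ge> d" "norm (z - x) + norm (t + y) \<ge> d"
      by (auto simp: sum_norm_def)
    have "norm (z - x) + norm (t - y) < \<epsilon> \<or> norm (z + x) + norm (t + y) < \<epsilon>"
      using z t sep unfolding \<rho>_def by linarith
    then show ?thesis
      by (auto simp: pm_dist_def sum_norm_def)
  qed
  moreover have "\<rho> > 0"
    using d assms by (simp add: \<rho>_def)
  ultimately show ?thesis using that by blast
qed

text \<open>For a point \<open>(x, y)\<close> take \<open>T z = f z *\<^sub>R u\<close>, where \<open>f\<close> norms \<open>x\<close> and \<open>y\<close> almost attains its norm at
  the unit vector \<open>u\<close>. If \<open>t (T z) = f z * t u\<close> is close to \<open>1\<close> in absolute value, then so are both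
  factors, as neither exceeds \<open>1\<close> in absolute value. Convexity then brings \<open>z\<close> close to \<open>x\<close> or \<open>- x\<close>, smoothness brings
  \<open>t\<close> close to \<open>y\<close> or \<open>- y\<close>, and the signs agree. The size \<open>\<delta>\<close> of the peak does not depend on
  the point, which in the end makes the porosity constants independent of the function.\<close>

lemma rank_one_peak:
  assumes X: "uniformly_convex TYPE('x)" and Y: "uniformly_smooth TYPE('y)" and "0 < \<epsilon>"
  obtains \<delta> where "0 < \<delta>"
    "\<And>p. p \<in> Pi_set \<theta> \<Longrightarrow> \<exists>T :: 'x \<Rightarrow>\<^sub>L 'y. finite_rank T \<and> norm T \<le> 1 \<and>
      blinfun_apply (snd p) (T (fst p)) > 1 - \<delta> / 4 \<and>
      (\<forall>q\<in>Pi_set \<theta>. \<bar>blinfun_apply (snd q) (T (fst q))\<bar> > 1 - \<delta> \<longrightarrow> pm_dist q p < \<epsilon>)"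
proof -
  obtain \<rho> where \<rho>: "\<rho> > 0" "\<And>x y z t. \<lbrakk>(x, y) \<in> Pi_set \<theta>; (z, t) \<in> Pi_set \<theta>;
      norm (z - x) < \<rho> \<or> norm (z + x) < \<rho>; norm (t - y) < \<rho> \<or> norm (t + y) < \<rho>\<rbrakk>
      \<Longrightarrow> pm_dist (z, t) (x, y) < \<epsilon>"
    using signs_agree[OF \<open>0 < \<epsilon>\<close>] by blast
  obtain a where a: "a > 0" "\<And>(f :: 'x \<Rightarrow>\<^sub>L real) x z. \<lbrakk>norm f \<le> 1; norm x = 1; norm z = 1;
      blinfun_apply f x = 1; blinfun_apply f z > 1 - a\<rbrakk> \<Longrightarrow> norm (z - x) < \<rho>"
    using uniformly_convex_peak[OF X \<rho>(1)] by blast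
  obtain b where b: "b > 0" "\<And>(y :: 'y \<Rightarrow>\<^sub>L real) t u. \<lbrakk>norm y \<le> 1; norm t \<le> 1; norm u = 1;
      blinfun_apply y u > 1 - b; blinfun_apply t u > 1 - b\<rbrakk> \<Longrightarrow> norm (t - y) < \<rho>"
    using uniformly_smooth_peak[OF Y \<rho>(1)] by blast
  define \<delta> where "\<delta> = Min {a, b, 1}"
  have \<delta>: "0 < \<delta>" "\<delta> \<le> a" "\<delta> \<le> b" "\<delta> \<le> 1"
    using a(1) b(1) by (auto simp: \<delta>_def)
  show ?thesis
  proof (rule that[OF \<delta>(1)])
    fix p assume p: "p \<in> Pi_set \<theta>"
    obtain x y where xy: "p = (x, y)" by (cases p)
    have nx: "norm x = 1" and ny: "norm y = 1"
      using p xy by (auto simp: Pi_set_def)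
    obtain f :: "'x \<Rightarrow>\<^sub>L real" where f: "norm f \<le> 1" "f x = 1"
      using norming_functional[of x] nx by auto
    obtain u where u: "norm u = 1" "1 - \<delta> / 4 < y u"
      using almost_norm_attained[of "1 - \<delta> / 4" y] \<delta> ny by auto
    have f_le: "\<bar>f z\<bar> \<le> norm z" for z
      using norm_blinfun[of f z] mult_right_mono[OF f(1) norm_ge_zero[of z]] by simp
    have bl: "bounded_linear (\<lambda>z. f z *\<^sub>R u)"
      by (intro bounded_linear_intros)
    define T where "T = Blinfun (\<lambda>z. f z *\<^sub>R u)"
    have T: "T z = f z *\<^sub>R u" for z
      by (simp add: T_def bounded_linear_Blinfun_apply[OF bl])
    show "\<exists>T :: 'x \<Rightarrow>\<^sub>L 'y. finite_rank T \<and> norm T \<le> 1 \<and> blinfun_apply (snd p) (T (fst p)) > 1 - \<delta> / 4 \<and>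
      (\<forall>q\<in>Pi_set \<theta>. \<bar>blinfun_apply (snd q) (T (fst q))\<bar> > 1 - \<delta> \<longrightarrow> pm_dist q p < \<epsilon>)"
    proof (intro exI[of _ T] conjI ballI impI)
      have "range T \<subseteq> span {u}"
        by (auto simp: T intro: span_scale span_base)
      then show "finite_rank T"
        unfolding finite_rank_def by (meson finite.emptyI finite.insertI)
      show "norm T \<le> 1"
        by (rule norm_blinfun_bound) (auto simp: T u f_le)
      show "blinfun_apply (snd p) (T (fst p)) > 1 - \<delta> / 4"
        using u f by (simp add: xy T blinfun.scaleR_right)
    next
      fix q assume q: "q \<in> Pi_set \<theta>" and big: "\<bar>blinfun_apply (snd q) (T (fst q))\<bar> > 1 - \<delta>"
      obtain z t where zt: "q = (z, t)" by (cases q)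
      have nz: "norm z = 1" and nt: "norm t = 1"
        using q zt by (auto simp: Pi_set_def)
      have fz: "\<bar>f z\<bar> \<le> 1" and tu: "\<bar>t u\<bar> \<le> 1"
        using f_le[of z] norm_blinfun[of t u] nz nt u by auto
      have prod: "\<bar>f z\<bar> * \<bar>t u\<bar> > 1 - \<delta>"
        using big by (simp add: zt T blinfun.scaleR_right abs_mult)
      have "\<bar>f z\<bar> > 1 - a"
        using prod mult_left_mono[OF tu abs_ge_zero[of "f z"]] \<delta> by simp
      then have "f z > 1 - a \<or> f (- z) > 1 - a"
        by (auto simp: blinfun.minus_right)
      then have 1: "norm (z - x) < \<rho> \<or> norm (z + x) < \<rho>"
        using a(2)[OF f(1) nx _ f(2), of z] a(2)[OF f(1) nx _ f(2), of "- z"] nz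
          norm_minus_cancel[of "z + x"]
        by (auto simp: norm_minus_commute)
      have "\<bar>t u\<bar> > 1 - b"
        using prod mult_right_mono[OF fz abs_ge_zero[of "t u"]] \<delta> by simp
      then have "t u > 1 - b \<or> (- t) u > 1 - b"
        by (auto simp: blinfun.minus_left)
      moreover have "y u > 1 - b"
        using u(2) \<delta> by linarith
      ultimately have 2: "norm (t - y) < \<rho> \<or> norm (t + y) < \<rho>"
        using b(2)[of y t u] b(2)[of y "- t" u] nt ny u(1) norm_minus_cancel[of "t + y"]
        by (auto simp: norm_minus_commute)
      show "pm_dist q p < \<epsilon>"
        using \<rho>(2)[of x y z t] p q 1 2 by (simp add: xy zt)
    qed
  qed
qed


section \<open>Localisation of near-maximisers\<close>

lemma norm_le_num_radius:
  assumes "bounded (F ` Pi_set \<theta>)" "q \<in> Pi_set \<theta>"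
  shows "norm (F q) \<le> num_radius \<theta> F"
  unfolding num_radius_def
  using assms by (intro cSUP_upper) (auto simp: bounded_iff bdd_above_def)

lemma num_radius_le:
  assumes "\<And>q. q \<in> Pi_set \<theta> \<Longrightarrow> norm (F q) \<le> a"
  shows "num_radius \<theta> F \<le> a"
  unfolding num_radius_def using Pi_nonempty assms by (intro cSUP_least)

lemma near_maximiser:
  assumes "bounded (F ` Pi_set \<theta>)" "a < num_radius \<theta> F"
  obtains p where "p \<in> Pi_set \<theta>" "a < norm (F p)"
  using assms num_radius_le[of F a] by (meson not_less)

text \<open>The vector \<open>w\<close> is the direction of \<open>F p\<close>, so the rank-one term raises the norm at \<open>p\<close> by
  almost \<open>r / 2\<close>. A near-maximiser of the perturbed function must receive nearly as much from the
  rank-one term, because before the perturbation no point exceeded \<open>p\<close> by more than \<open>c * r\<close>; hence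
  it lies where the rank-one term peaks, near \<open>p\<close> or \<open>- p\<close>. The argument leaves room for a
  further error of size \<open>c * r\<close>, with \<open>c\<close> depending only on \<open>\<epsilon>\<close>.\<close>

lemma localising_perturbation:
  assumes X: "uniformly_convex TYPE('x)" and Y: "uniformly_smooth TYPE('y)"
    and W: "\<exists>w::'w::real_normed_vector. w \<noteq> 0" and "0 < \<epsilon>"
  obtains c where "0 < c" "c \<le> 1 / 2"
    "\<And>(F :: 'x \<times> ('y \<Rightarrow>\<^sub>L real) \<Rightarrow> 'w) r p.
      \<lbrakk>0 < r; bounded (F ` Pi_set \<theta>); p \<in> Pi_set \<theta>; norm (F p) > num_radius \<theta> F - c * r\<rbrakk> \<Longrightarrow>
      \<exists>T w. finite_rank T \<and> norm T * norm w \<le> r / 2 \<and>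
        (\<forall>G. bounded (G ` Pi_set \<theta>) \<longrightarrow>
          (\<forall>q\<in>Pi_set \<theta>. norm (G q - (F q + rank_fun \<theta> T w q)) \<le> c * r) \<longrightarrow>
          (\<forall>q\<in>Pi_set \<theta>. norm (G q) > num_radius \<theta> G - c * r \<longrightarrow> pm_dist q p < \<epsilon>))"
proof -
  obtain \<delta> where \<delta>: "0 < \<delta>" and peak:
    "\<And>p. p \<in> Pi_set \<theta> \<Longrightarrow> \<exists>T :: 'x \<Rightarrow>\<^sub>L 'y. finite_rank T \<and> norm T \<le> 1 \<and>
      blinfun_apply (snd p) (T (fst p)) > 1 - \<delta> / 4 \<and>
      (\<forall>q\<in>Pi_set \<theta>. \<bar>blinfun_apply (snd q) (T (fst q))\<bar> > 1 - \<delta> \<longrightarrow> pm_dist q p < \<epsilon>)"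
    using rank_one_peak[OF X Y \<open>0 < \<epsilon>\<close>] by blast
  \<comment> \<open>Four errors of size \<open>c * r\<close> occur below, that is \<open>8 * c\<close> relative to \<open>r / 2\<close>. Together with the
    loss \<open>\<delta> / 4\<close> at \<open>p\<close> this stays below \<open>\<delta>\<close>. The bound \<open>1 / 2\<close> keeps a ball of radius \<open>c * r\<close>
    around the perturbed function inside the ball of radius \<open>r\<close> around the original one.\<close>
  define c where "c = min (1 / 2) (\<delta> / 16)"
  have c: "0 < c" "c \<le> 1 / 2" "c \<le> \<delta> / 16"
    using \<delta> by (auto simp: c_def)
  show ?thesis
  proof (rule that[OF c(1,2)])
    fix F :: "'x \<times> ('y \<Rightarrow>\<^sub>L real) \<Rightarrow> 'w" and r :: real and p
    assume r: "0 < r" and F: "bounded (F ` Pi_set \<theta>)" and p: "p \<in> Pi_set \<theta>"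
      and near: "norm (F p) > num_radius \<theta> F - c * r"
    obtain T :: "'x \<Rightarrow>\<^sub>L 'y" where T: "finite_rank T" "norm T \<le> 1"
      "blinfun_apply (snd p) (T (fst p)) > 1 - \<delta> / 4"
      "\<And>q. q \<in> Pi_set \<theta> \<Longrightarrow> \<bar>blinfun_apply (snd q) (T (fst q))\<bar> > 1 - \<delta> \<Longrightarrow> pm_dist q p < \<epsilon>"
      using peak[OF p] by blast
    obtain e :: 'w where e: "norm e = 1" "F p = norm (F p) *\<^sub>R e"
    proof (cases "F p = 0")
      case True
      obtain w :: 'w where "w \<noteq> 0" using W by blast
      then show ?thesis using True that[of "sgn w"] by (simp add: norm_sgn)
    next
      case False
      then show ?thesis using that[of "sgn (F p)"] by (simp add: norm_sgn sgn_div_norm)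
    qed
    define w where "w = (r / 2) *\<^sub>R e"
    have "norm T * norm w \<le> r / 2"
      using T(2) r e(1) by (simp add: w_def)
    moreover have "pm_dist q p < \<epsilon>"
      if G: "bounded (G ` Pi_set \<theta>)"
        and close: "\<And>q. q \<in> Pi_set \<theta> \<Longrightarrow> norm (G q - (F q + rank_fun \<theta> T w q)) \<le> c * r"
        and q: "q \<in> Pi_set \<theta>" and big: "norm (G q) > num_radius \<theta> G - c * r" for G q
    proof -
      define \<tau> where "\<tau> q = blinfun_apply (snd q) (T (fst q))" for q :: "'x \<times> ('y \<Rightarrow>\<^sub>L real)"
      have rank: "rank_fun \<theta> T w q = (\<tau> q * r / 2) *\<^sub>R e" if "q \<in> Pi_set \<theta>" for q
        using that by (auto simp: rank_fun_def \<tau>_def w_def split: prod.split)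
      have "F p + rank_fun \<theta> T w p = (norm (F p) + \<tau> p * r / 2) *\<^sub>R e"
        using e(2) rank[OF p] by (metis scaleR_add_left)
      then have "norm (F p) + \<tau> p * r / 2 \<le> norm (F p + rank_fun \<theta> T w p)"
        using e(1) by simp
      also have "\<dots> \<le> norm (G p) + norm (G p - (F p + rank_fun \<theta> T w p))"
        by (metis norm_minus_commute norm_triangle_sub)
      also have "\<dots> \<le> num_radius \<theta> G + c * r"
        using norm_le_num_radius[OF G p] close[OF p] by linarith
      finally have lower: "norm (F p) + \<tau> p * r / 2 \<le> num_radius \<theta> G + c * r" .
      have "norm (G q) \<le> norm (F q + rank_fun \<theta> T w q) + norm (G q - (F q + rank_fun \<theta> T w q))"
        by (rule norm_triangle_sub)
      also have "\<dots> \<le> norm (F q) + norm (rank_fun \<theta> T w q) + c * r"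
        using norm_triangle_ineq[of "F q" "rank_fun \<theta> T w q"] close[OF q] by linarith
      also have "\<dots> \<le> num_radius \<theta> F + \<bar>\<tau> q\<bar> * r / 2 + c * r"
        using norm_le_num_radius[OF F q] rank[OF q] e(1) r by (simp add: abs_mult)
      finally have upper: "norm (G q) \<le> num_radius \<theta> F + \<bar>\<tau> q\<bar> * r / 2 + c * r" .
      have "\<tau> p * r / 2 - 4 * (c * r) < \<bar>\<tau> q\<bar> * r / 2"
        using lower upper big near by linarith
      then have "r * (\<tau> p - 8 * c) < r * \<bar>\<tau> q\<bar>"
        by (simp add: algebra_simps)
      then have "\<tau> p - 8 * c < \<bar>\<tau> q\<bar>"
        using r by simp
      then have "\<bar>\<tau> q\<bar> > 1 - \<delta>"
        using T(3) c(3) \<delta> by (simp add: \<tau>_def)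
      then show ?thesis
        using T(4)[OF q] by (simp add: \<tau>_def)
    qed
    ultimately show "\<exists>T w. finite_rank T \<and> norm T * norm w \<le> r / 2 \<and>
        (\<forall>G. bounded (G ` Pi_set \<theta>) \<longrightarrow>
          (\<forall>q\<in>Pi_set \<theta>. norm (G q - (F q + rank_fun \<theta> T w q)) \<le> c * r) \<longrightarrow>
          (\<forall>q\<in>Pi_set \<theta>. norm (G q) > num_radius \<theta> G - c * r \<longrightarrow> pm_dist q p < \<epsilon>))"
      using T(1) by blast
  qed
qed

end

definition localised ::
  "('x::real_normed_vector \<times> ('y::real_normed_vector \<Rightarrow>\<^sub>L real) \<Rightarrow> real) \<Rightarrow>
    ('x \<times> ('y \<Rightarrow>\<^sub>L real) \<Rightarrow> 'w::real_normed_vector) \<Rightarrow> real \<Rightarrow> bool"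
  where "localised \<theta> F \<epsilon> \<longleftrightarrow> (\<exists>p\<in>Pi_set \<theta>. \<exists>\<gamma>>0. \<forall>q\<in>Pi_set \<theta>.
     norm (F q) > num_radius \<theta> F - \<gamma> \<longrightarrow> pm_dist q p < \<epsilon>)"

text \<open>Points of \<open>Pi_set \<theta>\<close> have norm 2, so a point cannot be close both to \<open>p\<close> and to \<open>- p\<close>. Replacing
  the members of a maximising sequence by their negatives where necessary, so that they
  eventually lie close to one point, thus makes the sequence Cauchy, and its limit is the strong maximiser.\<close>

lemma attains_strongly_if_localised:
  fixes \<theta> :: "'x::banach \<times> ('y::real_normed_vector \<Rightarrow>\<^sub>L real) \<Rightarrow> real"
    and F :: "'x \<times> ('y \<Rightarrow>\<^sub>L real) \<Rightarrow> 'w::real_normed_vector"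
  assumes "odd_theta \<theta>" and cont: "continuous_on (Pi_set \<theta>) F" and bdd: "bounded (F ` Pi_set \<theta>)"
    and even: "\<And>p. p \<in> Pi_set \<theta> \<Longrightarrow> F (- p) = F p"
    and loc: "\<And>\<epsilon>. 0 < \<epsilon> \<Longrightarrow> localised \<theta> F \<epsilon>"
  shows "attains_strongly \<theta> F"
proof -
  interpret odd_theta \<theta> by fact
  define v where "v = num_radius \<theta> F"
  have close: "\<exists>p\<in>Pi_set \<theta>. \<forall>\<^sub>F n in sequentially. pm_dist (s n) p < \<epsilon>"
    if "0 < \<epsilon>" "\<And>n. s n \<in> Pi_set \<theta>" "(\<lambda>n. norm (F (s n))) \<longlonglongrightarrow> v" for s :: "nat \<Rightarrow> _" and \<epsilon>
  proof -
    obtain p \<gamma> where p: "p \<in> Pi_set \<theta>" "0 < \<gamma>" and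
      *: "\<And>q. q \<in> Pi_set \<theta> \<Longrightarrow> norm (F q) > v - \<gamma> \<Longrightarrow> pm_dist q p < \<epsilon>"
      using loc[OF \<open>0 < \<epsilon>\<close>] unfolding localised_def v_def by blast
    have "\<forall>\<^sub>F n in sequentially. norm (F (s n)) > v - \<gamma>"
      using that(3) p(2) by (intro order_tendstoD(1)) auto
    then show ?thesis
      using p(1) by (intro bexI[of _ p]) (auto elim!: eventually_mono intro: * that(2))
  qed
  \<comment> \<open>a maximising sequence, which \<open>close\<close> confines up to sign to arbitrarily small balls\<close>
  have "\<exists>q\<in>Pi_set \<theta>. v - 1 / Suc n < norm (F q)" for n
    using near_maximiser[OF bdd, of "v - 1 / Suc n"] by (auto simp: v_def)
  then obtain s' where s': "\<And>n. s' n \<in> Pi_set \<theta>" "\<And>n. v - 1 / Suc n < norm (F (s' n))"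
    by metis
  have lim': "(\<lambda>n. norm (F (s' n))) \<longlonglongrightarrow> v"
  proof (rule tendsto_sandwich)
    show "(\<lambda>n. v - 1 / Suc n) \<longlonglongrightarrow> v"
      using tendsto_diff[OF tendsto_const LIMSEQ_inverse_real_of_nat, of v]
      by (simp add: inverse_eq_divide)
    show "(\<lambda>n. v) \<longlonglongrightarrow> v" by simp
    show "\<forall>\<^sub>F n in sequentially. v - 1 / Suc n \<le> norm (F (s' n))"
      by (intro always_eventually allI less_imp_le s'(2))
    show "\<forall>\<^sub>F n in sequentially. norm (F (s' n)) \<le> v"
      using norm_le_num_radius[OF bdd s'(1)] by (simp add: v_def)
  qed
  obtain b where b: "b \<in> Pi_set \<theta>" "\<forall>\<^sub>F n in sequentially. pm_dist (s' n) b < 1 / 2"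
    using close[of "1 / 2" s'] s'(1) lim' by auto
  define s where "s n = (if sum_norm (s' n - b) \<le> sum_norm (s' n + b) then s' n else - s' n)" for n
  have s_cases: "s n = s' n \<or> s n = - s' n" for n
    by (simp add: s_def)
  have s: "s n \<in> Pi_set \<theta>" "F (s n) = F (s' n)" for n
    using s'(1)[of n] s_cases[of n] Pi_minus even by metis+
  have lim: "(\<lambda>n. norm (F (s n))) \<longlonglongrightarrow> v"
    using lim' by (simp add: s)
  have near_b: "\<forall>\<^sub>F n in sequentially. sum_norm (s n - b) < 1 / 2"
    using b(2)
  proof eventually_elim
    case (elim n)
    have "- s' n - b = - (s' n + b)" by simp
    then have "sum_norm (- s' n - b) = sum_norm (s' n + b)"
      by (metis sum_norm_minus)
    then show ?case
      using elim by (auto simp: s_def pm_dist_def)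
  qed
  have "Cauchy s"
  proof (rule metric_CauchyI)
    fix e :: real assume e: "0 < e"
    define \<epsilon> where "\<epsilon> = min e 1 / 2"
    have "0 < \<epsilon>" using e by (simp add: \<epsilon>_def)
    then obtain p where "\<forall>\<^sub>F n in sequentially. pm_dist (s n) p < \<epsilon>"
      using close[of \<epsilon> s] s(1) lim by blast
    with near_b have "\<forall>\<^sub>F n in sequentially. pm_dist (s n) p < \<epsilon> \<and> sum_norm (s n - b) < 1 / 2"
      by eventually_elim simp
    then obtain M where M: "\<And>n. n \<ge> M \<Longrightarrow> pm_dist (s n) p < \<epsilon> \<and> sum_norm (s n - b) < 1 / 2"
      by (auto simp: eventually_sequentially)
    have "dist (s m) (s n) < e" if "m \<ge> M" "n \<ge> M" for m n
    proof -
      have "pm_dist (s m) (s n) < 2 * \<epsilon>"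
        using pm_dist_triangle[where p = "s m" and q = p and r = "s n"]
          pm_dist_commute[of p "s n"] M[OF that(1)] M[OF that(2)] by linarith
      \<comment> \<open>\<open>s m\<close> and \<open>s n\<close> are both within \<open>1 / 2\<close> of \<open>b\<close>, and \<open>b + b\<close> has norm 4, so in
        \<open>pm_dist (s m) (s n)\<close> the minimum is not taken at the sum\<close>
      moreover have "sum_norm (s m + s n) \<ge> 3"
      proof -
        have "sum_norm (b + b) = 4"
          using sum_norm_Pi[OF b(1)] by (simp add: sum_norm_def scaleR_2[symmetric])
        moreover have "b + b = (s m + s n) + (- (s m - b) + - (s n - b))" by simp
        ultimately have "4 \<le> sum_norm (s m + s n) + sum_norm (- (s m - b) + - (s n - b))"
          by (metis sum_norm_triangle)
        also have "sum_norm (- (s m - b) + - (s n - b)) \<le> sum_norm (s m - b) + sum_norm (s n - b)"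
          using sum_norm_triangle[of "- (s m - b)" "- (s n - b)"] by (simp only: sum_norm_minus)
        finally show ?thesis
          using M[OF that(1)] M[OF that(2)] by linarith
      qed
      ultimately have "sum_norm (s m - s n) < e"
        by (auto simp: pm_dist_def \<epsilon>_def)
      then show ?thesis
        using norm_le_sum_norm[of "s m - s n"] by (simp add: dist_norm)
    qed
    then show "\<exists>M. \<forall>m\<ge>M. \<forall>n\<ge>M. dist (s m) (s n) < e" by blast
  qed
  then obtain p where p: "s \<longlonglongrightarrow> p"
    using Cauchy_convergent_iff convergent_def by blast
  then have p_Pi: "p \<in> Pi_set \<theta>"
    using closed_sequentially[OF closed_Pi] s(1) by blast
  have "(\<lambda>n. F (s n)) \<longlonglongrightarrow> F p"
    using cont p p_Pi s(1) by (auto simp: continuous_on_sequentially o_def)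
  then have Fp: "norm (F p) = v"
    using lim LIMSEQ_unique tendsto_norm by blast
  show ?thesis
    unfolding attains_strongly_def
  proof (intro bexI[of _ p] conjI allI impI)
    \<comment> \<open>at every scale, \<open>p\<close> and the tail of \<open>t\<close> are up to sign close to the same point\<close>
    fix t :: "nat \<Rightarrow> 'x \<times> ('y \<Rightarrow>\<^sub>L real)"
    assume t: "\<forall>n. t n \<in> Pi_set \<theta>" "(\<lambda>n. norm (F (t n))) \<longlonglongrightarrow> num_radius \<theta> F"
    have "(\<lambda>n. pm_dist (t n) p) \<longlonglongrightarrow> 0"
    proof (rule metric_LIMSEQ_I)
      fix e :: real assume e: "0 < e"
      obtain a \<gamma> where a: "0 < \<gamma>" and
        *: "\<And>q. q \<in> Pi_set \<theta> \<Longrightarrow> norm (F q) > v - \<gamma> \<Longrightarrow> pm_dist q a < e / 2"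
        using loc[of "e / 2"] e unfolding localised_def v_def by auto
      have "\<forall>\<^sub>F n in sequentially. norm (F (t n)) > v - \<gamma>"
        using t(2) a by (intro order_tendstoD(1)) (auto simp: v_def)
      then obtain M where M: "\<And>n. n \<ge> M \<Longrightarrow> norm (F (t n)) > v - \<gamma>"
        by (auto simp: eventually_sequentially)
      have "dist (pm_dist (t n) p) 0 < e" if "n \<ge> M" for n
      proof -
        have "pm_dist (t n) p \<le> pm_dist (t n) a + pm_dist p a"
          using pm_dist_triangle pm_dist_commute by metis
        also have "\<dots> < e"
          using *[OF _ M[OF that]] *[OF p_Pi] t(1) Fp a by fastforce
        finally show ?thesis
          by (simp add: pm_dist_def sum_norm_def)
      qed
      then show "\<exists>M. \<forall>n\<ge>M. dist (pm_dist (t n) p) 0 < e" by blast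
    qed
    then show "(\<lambda>n. min (sum_norm (t n - p)) (sum_norm (t n + p))) \<longlonglongrightarrow> 0"
      by (simp add: pm_dist_def)
  qed (use Fp p_Pi in \<open>auto simp: v_def\<close>)
qed


section \<open>Porosity and density\<close>

lemma porous_in_subset: "porous_in m A \<Longrightarrow> B \<subseteq> A \<Longrightarrow> porous_in m B"
  unfolding porous_in_def by (meson Diff_mono Int_mono order_refl order_trans)

text \<open>A porous set misses an open dense set, so the claim is an instance of the Baire category
  theorem.\<close>

lemma sigma_porous_complement_dense:
  assumes complete: "mcomplete_of m" and A: "sigma_porous_in m A" and x: "x \<in> mspace m" and r: "0 < r"
  obtains y where "y \<in> mspace m - A" "mdist m x y < r"
proof -
  interpret Metric_space "mspace m" "mdist m"
    by (rule Metric_space_mspace_mdist)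
  obtain \<A> where \<A>: "countable \<A>" "\<And>B. B \<in> \<A> \<Longrightarrow> porous_in m B" "A = \<Union>\<A>"
    using A unfolding sigma_porous_in_def by blast
  define U where "U B = mtopology interior_of (mspace m - B)" for B
  have dense: "mtopology closure_of (U B) = mspace m" if "B \<in> \<A>" for B
  proof -
    obtain c r\<^sub>0 where c: "0 < c" and r0: "0 < r\<^sub>0" and
      *: "\<And>x r. x \<in> mspace m \<Longrightarrow> 0 < r \<Longrightarrow> r \<le> r\<^sub>0 \<Longrightarrow>
        \<exists>y\<in>mspace m. mball_of m y (c * r) \<subseteq> mball_of m x r \<inter> (mspace m - B)"
      using \<A>(2)[OF \<open>B \<in> \<A>\<close>] unfolding porous_in_def by blast
    have "\<exists>y\<in>U B. y \<in> mball x e" if x: "x \<in> mspace m" and e: "0 < e" for x e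
    proof -
      obtain y where y: "y \<in> mspace m" "mball_of m y (c * min e r\<^sub>0) \<subseteq> mball_of m x (min e r\<^sub>0) \<inter> (mspace m - B)"
        using *[OF x, of "min e r\<^sub>0"] e r0 by auto
      have "0 < c * min e r\<^sub>0" using c e r0 by simp
      then have "y \<in> mball_of m y (c * min e r\<^sub>0)"
        using y(1) by simp
      moreover have "mball_of m y (c * min e r\<^sub>0) \<subseteq> U B"
        unfolding U_def using y(2) by (intro interior_of_maximal) (auto simp: mball_of_def)
      ultimately show "\<exists>y\<in>U B. y \<in> mball x e"
        using x y(2) by (intro bexI[of _ y]) (auto simp: subset_iff)
    qed
    then show ?thesis
      by (auto simp: metric_closure_of)
  qed
  have "mtopology closure_of \<Inter>(U ` \<A>) = mspace m"
    using complete \<A>(1) dense by (intro metric_Baire_category) (auto simp: mcomplete_of_def U_def)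
  then have "\<exists>y\<in>\<Inter>(U ` \<A>). y \<in> mball x r"
    using x r by (auto simp: metric_closure_of)
  then obtain y where y: "\<And>B. B \<in> \<A> \<Longrightarrow> y \<in> U B" "y \<in> mball x r"
    by blast
  have "y \<in> mspace m - A"
    using y interior_of_subset[of mtopology] \<A>(3) unfolding U_def by fastforce
  with y(2) that show ?thesis by auto
qed

section \<open>Function spaces containing the finite-rank forms\<close>

locale finite_rank_function_space = odd_theta \<theta>
  for \<theta> :: "'x::banach \<times> ('y::banach \<Rightarrow>\<^sub>L real) \<Rightarrow> real" +
  fixes Z :: "('x \<times> ('y \<Rightarrow>\<^sub>L real) \<Rightarrow> 'w::banach) set"
    and N :: "('x \<times> ('y \<Rightarrow>\<^sub>L real) \<Rightarrow> 'w) \<Rightarrow> real"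
  assumes W_nonzero: "\<exists>w::'w. w \<noteq> 0"
    and X_uniformly_convex: "uniformly_convex TYPE('x)"
    and Y_uniformly_smooth: "uniformly_smooth TYPE('y)"
    and Z_banach: "banach_function_space Z N"
    and Z_subset: "Z \<subseteq> Cbe \<theta>"
    and N_ge_sup_norm: "\<And>\<Phi>. \<Phi> \<in> Z \<Longrightarrow> num_radius \<theta> \<Phi> \<le> N \<Phi>"
    and Z_contains_finite_rank: "\<And>T w. finite_rank T \<Longrightarrow>
          rank_fun \<theta> T w \<in> Z \<and> N (rank_fun \<theta> T w) \<le> norm T * norm w"
begin

abbreviation M where "M \<equiv> norm_metric Z N"

lemma Z_normed: "normed_function_space Z N"
  using Z_banach by (simp add: banach_function_space_def)

lemma mspace_M [simp]: "mspace M = Z"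
  by (rule mspace_norm_metric[OF Z_normed])

lemma Z_add: "f \<in> Z \<Longrightarrow> g \<in> Z \<Longrightarrow> (\<lambda>p. f p + g p) \<in> Z"
  and Z_scaleR: "f \<in> Z \<Longrightarrow> (\<lambda>p. c *\<^sub>R f p) \<in> Z"
  and N_scaleR: "f \<in> Z \<Longrightarrow> N (\<lambda>p. c *\<^sub>R f p) = \<bar>c\<bar> * N f"
  using Z_normed unfolding normed_function_space_def by blast+

lemma mdist_add_rank_fun:
  assumes "\<Phi> \<in> Z" "finite_rank T"
  shows "mdist M \<Phi> (\<lambda>p. \<Phi> p + rank_fun \<theta> T w p) \<le> norm T * norm w"
proof -
  have "rank_fun \<theta> T w \<in> Z" "N (rank_fun \<theta> T w) \<le> norm T * norm w"
    using Z_contains_finite_rank[OF assms(2)] by auto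
  then show ?thesis
    using assms(1) N_scaleR[of "rank_fun \<theta> T w" "- 1"]
    by (simp add: mdist_norm_metric[OF Z_normed] Z_add)
qed

lemma Cbe_bounded: "F \<in> Cbe \<theta> \<Longrightarrow> bounded (F ` Pi_set \<theta>)"
  by (simp add: Cbe_def)

lemma Cbe_even: "F \<in> Cbe \<theta> \<Longrightarrow> p \<in> Pi_set \<theta> \<Longrightarrow> F (- p) = F p"
  unfolding Cbe_def by (cases p) force

lemma norm_diff_le_mdist:
  assumes "f \<in> Z" "g \<in> Z" "q \<in> Pi_set \<theta>"
  shows "norm (f q - g q) \<le> mdist M f g"
proof -
  have diff: "(\<lambda>p. f p - g p) \<in> Z"
    using Z_add[OF assms(1) Z_scaleR[OF assms(2), of "- 1"]] by simp
  then have "norm (f q - g q) \<le> num_radius \<theta> (\<lambda>p. f p - g p)"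
    using norm_le_num_radius[OF Cbe_bounded assms(3), of "\<lambda>p. f p - g p"] Z_subset by auto
  also have "\<dots> \<le> mdist M f g"
    using N_ge_sup_norm[OF diff] assms by (simp add: mdist_norm_metric[OF Z_normed])
  finally show ?thesis .
qed

lemma Cbe_add: "f \<in> Cbe \<theta> \<Longrightarrow> g \<in> Cbe \<theta> \<Longrightarrow> (\<lambda>p. f p + g p) \<in> Cbe \<theta>"
  unfolding Cbe_def by (auto intro!: continuous_intros bounded_plus_comp split: prod.splits)

text \<open>Perturbing by a rank-one term of norm at most \<open>r / 2\<close> gives a function all of whose neighbours
  within \<open>c * r\<close> have localised near-maximisers. As \<open>c\<close> depends on \<open>\<epsilon>\<close> only, it serves as the
  porosity constant.\<close>

lemma porous_not_localised:
  assumes \<Theta>: "\<Theta> \<in> Cbe \<theta>" and "0 < \<epsilon>"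
  shows "porous_in M {\<Phi> \<in> Z. \<not> localised \<theta> (\<lambda>p. \<Theta> p + \<Phi> p) \<epsilon>}" (is "porous_in M ?A")
proof -
  obtain c where c: "0 < c" "c \<le> 1 / 2" and perturb:
    "\<And>(F :: 'x \<times> ('y \<Rightarrow>\<^sub>L real) \<Rightarrow> 'w) r p.
      \<lbrakk>0 < r; bounded (F ` Pi_set \<theta>); p \<in> Pi_set \<theta>; norm (F p) > num_radius \<theta> F - c * r\<rbrakk> \<Longrightarrow>
      \<exists>T w. finite_rank T \<and> norm T * norm w \<le> r / 2 \<and>
        (\<forall>G. bounded (G ` Pi_set \<theta>) \<longrightarrow>
          (\<forall>q\<in>Pi_set \<theta>. norm (G q - (F q + rank_fun \<theta> T w q)) \<le> c * r) \<longrightarrow>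
          (\<forall>q\<in>Pi_set \<theta>. norm (G q) > num_radius \<theta> G - c * r \<longrightarrow> pm_dist q p < \<epsilon>))"
    using localising_perturbation[OF X_uniformly_convex Y_uniformly_smooth W_nonzero \<open>0 < \<epsilon>\<close>]
    by blast
  have "\<exists>\<Psi>\<in>Z. mball_of M \<Psi> (c * r) \<subseteq> mball_of M \<Phi> r \<inter> (Z - ?A)"
    if \<Phi>: "\<Phi> \<in> Z" and r: "0 < r" for \<Phi> r
  proof -
    let ?F = "\<lambda>p. \<Theta> p + \<Phi> p"
    have F: "bounded (?F ` Pi_set \<theta>)"
      using Cbe_add \<Theta> \<Phi> Z_subset by (intro Cbe_bounded) auto
    obtain p where p: "p \<in> Pi_set \<theta>" "norm (?F p) > num_radius \<theta> ?F - c * r"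
      using near_maximiser[OF F, of "num_radius \<theta> ?F - c * r"] c r by auto
    obtain T w where T: "finite_rank T" "norm T * norm w \<le> r / 2" and
      *: "\<And>G q. bounded (G ` Pi_set \<theta>) \<Longrightarrow>
          (\<And>q. q \<in> Pi_set \<theta> \<Longrightarrow> norm (G q - (?F q + rank_fun \<theta> T w q)) \<le> c * r) \<Longrightarrow>
          q \<in> Pi_set \<theta> \<Longrightarrow> norm (G q) > num_radius \<theta> G - c * r \<Longrightarrow> pm_dist q p < \<epsilon>"
      using perturb[OF r F p] by metis
    define \<Psi> where "\<Psi> = (\<lambda>p. \<Phi> p + rank_fun \<theta> T w p)"
    have \<Psi>: "\<Psi> \<in> Z"
      using Z_add \<Phi> Z_contains_finite_rank[OF T(1)] by (simp add: \<Psi>_def)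
    have \<Phi>\<Psi>: "mdist M \<Phi> \<Psi> \<le> r / 2"
      using mdist_add_rank_fun[OF \<Phi> T(1), of w] T(2) by (simp add: \<Psi>_def)
    have "\<xi> \<in> mball_of M \<Phi> r \<and> \<xi> \<notin> ?A" if \<xi>: "\<xi> \<in> Z" "mdist M \<Psi> \<xi> < c * r" for \<xi>
    proof
      have "mdist M \<Phi> \<xi> \<le> mdist M \<Phi> \<Psi> + mdist M \<Psi> \<xi>"
        using mdist_triangle[of \<Phi> M \<Psi> \<xi>] \<Phi> \<Psi> \<xi> by simp
      also have "\<dots> < r"
        using \<Phi>\<Psi> \<xi>(2) mult_right_mono[OF c(2) less_imp_le[OF r]] by linarith
      finally show "\<xi> \<in> mball_of M \<Phi> r"
        using \<Phi> \<xi> by simp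
      let ?G = "\<lambda>p. \<Theta> p + \<xi> p"
      have "bounded (?G ` Pi_set \<theta>)"
        using Cbe_add \<Theta> \<xi> Z_subset by (intro Cbe_bounded) auto
      moreover have "norm (?G q - (?F q + rank_fun \<theta> T w q)) \<le> c * r" if "q \<in> Pi_set \<theta>" for q
        using norm_diff_le_mdist[OF \<Psi> \<xi>(1) that] \<xi>(2)
        by (simp add: \<Psi>_def norm_minus_commute algebra_simps)
      ultimately have "pm_dist q p < \<epsilon>"
        if "q \<in> Pi_set \<theta>" "norm (?G q) > num_radius \<theta> ?G - c * r" for q
        using *[of ?G q] that by blast
      then have "localised \<theta> ?G \<epsilon>"
        unfolding localised_def using p(1) c r by (intro bexI[of _ p] exI[of _ "c * r"]) auto
      then show "\<xi> \<notin> ?A" by simp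
    qed
    then show ?thesis
      using \<Psi> by (intro bexI[of _ \<Psi>]) auto
  qed
  then show ?thesis
    unfolding porous_in_def mspace_M using c by (intro conjI exI[of _ c] exI[of _ 1]) auto
qed

text \<open>Localisation at all the scales \<open>1 / Suc n\<close> implies strong attainment, so a function that does
  not attain strongly fails to be localised at one of them.\<close>

lemma sigma_porous_not_attains_strongly:
  assumes \<Theta>: "\<Theta> \<in> Cbe \<theta>"
  shows "sigma_porous_in M {\<Phi> \<in> Z. \<not> attains_strongly \<theta> (\<lambda>p. \<Theta> p + \<Phi> p)}"
    (is "sigma_porous_in M ?A")
proof -
  \<comment> \<open>restricting to \<open>?A\<close> makes the union of the porous pieces equal to \<open>?A\<close>\<close>
  define B where "B n = {\<Phi> \<in> ?A. \<not> localised \<theta> (\<lambda>p. \<Theta> p + \<Phi> p) (1 / Suc n)}" for n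
  have "porous_in M (B n)" for n
    by (rule porous_in_subset[OF porous_not_localised[OF \<Theta>, of "1 / Suc n"]]) (auto simp: B_def)
  moreover have "?A \<subseteq> (\<Union>n. B n)"
  proof
    fix \<Phi> assume \<Phi>: "\<Phi> \<in> ?A"
    let ?F = "\<lambda>p. \<Theta> p + \<Phi> p"
    have F: "?F \<in> Cbe \<theta>"
      using \<Theta> \<Phi> Z_subset Cbe_add by blast
    have "\<not> attains_strongly \<theta> ?F" using \<Phi> by simp
    then obtain \<epsilon> where \<epsilon>: "0 < \<epsilon>" "\<not> localised \<theta> ?F \<epsilon>"
      using attains_strongly_if_localised[OF odd_theta_axioms, of ?F] Cbe_even[OF F] F
      unfolding Cbe_def by blast
    obtain n where "1 / Suc n < \<epsilon>"
      using nat_approx_posE[OF \<epsilon>(1)] by auto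
    then have "\<not> localised \<theta> ?F (1 / Suc n)"
      using \<epsilon>(2) unfolding localised_def by (meson less_trans)
    then show "\<Phi> \<in> (\<Union>n. B n)"
      using \<Phi> by (auto simp: B_def)
  qed
  ultimately show ?thesis
    unfolding sigma_porous_in_def by (intro exI[of _ "range B"]) (auto simp: B_def)
qed

text \<open>Density of the strongly attaining functions turns the perturbation that localises
  near-maximisers around \<open>p\<close> into an attaining one; rescaling it to numerical radius 1 costs no more
  than the perturbation itself.\<close>

lemma bishop_phelps_bollobas:
  assumes \<epsilon>: "0 < \<epsilon>"
  obtains \<eta> where "0 < \<eta>"
    "\<And>\<Phi> p. \<lbrakk>\<Phi> \<in> Z; p \<in> Pi_set \<theta>; num_radius \<theta> \<Phi> = 1; norm (\<Phi> p) > 1 - \<eta>\<rbrakk> \<Longrightarrow>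
      \<exists>\<Psi>\<in>Z. \<exists>z\<in>Pi_set \<theta>. num_radius \<theta> \<Psi> = 1 \<and> norm (\<Psi> z) = 1 \<and> sum_norm (z - p) < \<epsilon> \<and>
        num_radius \<theta> (\<lambda>p. \<Psi> p - \<Phi> p) < \<epsilon>"
proof -
  obtain c where c: "0 < c" "c \<le> 1 / 2" and perturb:
    "\<And>(F :: 'x \<times> ('y \<Rightarrow>\<^sub>L real) \<Rightarrow> 'w) r p.
      \<lbrakk>0 < r; bounded (F ` Pi_set \<theta>); p \<in> Pi_set \<theta>; norm (F p) > num_radius \<theta> F - c * r\<rbrakk> \<Longrightarrow>
      \<exists>T w. finite_rank T \<and> norm T * norm w \<le> r / 2 \<and>
        (\<forall>G. bounded (G ` Pi_set \<theta>) \<longrightarrow>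
          (\<forall>q\<in>Pi_set \<theta>. norm (G q - (F q + rank_fun \<theta> T w q)) \<le> c * r) \<longrightarrow>
          (\<forall>q\<in>Pi_set \<theta>. norm (G q) > num_radius \<theta> G - c * r \<longrightarrow> pm_dist q p < \<epsilon>))"
    using localising_perturbation[OF X_uniformly_convex Y_uniformly_smooth W_nonzero \<open>0 < \<epsilon>\<close>]
    by blast
  \<comment> \<open>the perturbation and the rescaling each move the function by at most \<open>r\<close>; the bound \<open>1 / 2\<close>
    keeps the numerical radius away from \<open>0\<close>\<close>
  define r where "r = min (\<epsilon> / 4) (1 / 2)"
  have r: "0 < r" "r \<le> 1 / 2" "2 * r < \<epsilon>"
    using \<epsilon> by (auto simp: r_def)
  show ?thesis
  proof (rule that[of "c * r"])
    show "0 < c * r" using c r by simp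
    fix \<Phi> p
    assume \<Phi>: "\<Phi> \<in> Z" and p: "p \<in> Pi_set \<theta>" and v: "num_radius \<theta> \<Phi> = 1"
      and near: "norm (\<Phi> p) > 1 - c * r"
    have bdd: "bounded (f ` Pi_set \<theta>)" if "f \<in> Z" for f
      using that Z_subset by (intro Cbe_bounded) auto
    obtain T w where T: "finite_rank T" "norm T * norm w \<le> r / 2" and
      *: "\<And>G q. bounded (G ` Pi_set \<theta>) \<Longrightarrow>
          (\<And>q. q \<in> Pi_set \<theta> \<Longrightarrow> norm (G q - (\<Phi> q + rank_fun \<theta> T w q)) \<le> c * r) \<Longrightarrow>
          q \<in> Pi_set \<theta> \<Longrightarrow> norm (G q) > num_radius \<theta> G - c * r \<Longrightarrow> pm_dist q p < \<epsilon>"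
      using perturb[OF r(1) bdd[OF \<Phi>] p] near v by metis
    define \<Phi>\<^sub>1 where "\<Phi>\<^sub>1 = (\<lambda>p. \<Phi> p + rank_fun \<theta> T w p)"
    have \<Phi>\<^sub>1: "\<Phi>\<^sub>1 \<in> Z"
      using Z_add \<Phi> Z_contains_finite_rank[OF T(1)] by (simp add: \<Phi>\<^sub>1_def)
    have "(\<lambda>_. 0) \<in> Cbe \<theta>"
      by (auto simp: Cbe_def image_constant_conv)
    from sigma_porous_not_attains_strongly[OF this]
    have "sigma_porous_in M {\<Phi> \<in> Z. \<not> attains_strongly \<theta> \<Phi>}" by simp
    then obtain \<Phi>\<^sub>2 where \<Phi>\<^sub>2: "\<Phi>\<^sub>2 \<in> Z" "attains_strongly \<theta> \<Phi>\<^sub>2" "mdist M \<Phi>\<^sub>1 \<Phi>\<^sub>2 < c * r"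
      using sigma_porous_complement_dense[of M _ \<Phi>\<^sub>1 "c * r"] Z_banach \<Phi>\<^sub>1 c(1) r(1)
      by (auto simp: banach_function_space_def)
    define k where "k = num_radius \<theta> \<Phi>\<^sub>2"
    obtain q where q: "q \<in> Pi_set \<theta>" "norm (\<Phi>\<^sub>2 q) = k"
      using \<Phi>\<^sub>2(2) unfolding attains_strongly_def k_def by blast
    have "pm_dist q p < \<epsilon>"
    proof (rule *[OF bdd[OF \<Phi>\<^sub>2(1)] _ q(1)])
      show "norm (\<Phi>\<^sub>2 q - (\<Phi> q + rank_fun \<theta> T w q)) \<le> c * r" if "q \<in> Pi_set \<theta>" for q
        using norm_diff_le_mdist[OF \<Phi>\<^sub>1 \<Phi>\<^sub>2(1) that] \<Phi>\<^sub>2(3)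
        by (simp add: \<Phi>\<^sub>1_def norm_minus_commute)
      show "norm (\<Phi>\<^sub>2 q) > num_radius \<theta> \<Phi>\<^sub>2 - c * r"
        using q(2) c(1) r(1) by (simp add: k_def)
    qed
    moreover have "\<Phi>\<^sub>2 (- q) = \<Phi>\<^sub>2 q"
      using \<Phi>\<^sub>2(1) Z_subset q(1) Cbe_even by blast
    moreover have "sum_norm (- q - p) = sum_norm (q + p)"
      using sum_norm_minus[of "q + p"] by simp
    ultimately obtain z where z: "z \<in> Pi_set \<theta>" "norm (\<Phi>\<^sub>2 z) = k" "sum_norm (z - p) < \<epsilon>"
      using q Pi_minus[OF q(1)] unfolding pm_dist_def min_less_iff_disj by metis
    have close: "norm (\<Phi>\<^sub>2 q - \<Phi> q) \<le> r" if "q \<in> Pi_set \<theta>" for q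
    proof -
      have "norm (\<Phi> q - \<Phi>\<^sub>2 q) \<le> mdist M \<Phi> \<Phi>\<^sub>2"
        by (rule norm_diff_le_mdist[OF \<Phi> \<Phi>\<^sub>2(1) that])
      also have "\<dots> \<le> mdist M \<Phi> \<Phi>\<^sub>1 + mdist M \<Phi>\<^sub>1 \<Phi>\<^sub>2"
        using mdist_triangle[of \<Phi> M \<Phi>\<^sub>1 \<Phi>\<^sub>2] \<Phi> \<Phi>\<^sub>1 \<Phi>\<^sub>2 by simp
      also have "\<dots> \<le> r / 2 + c * r"
        using mdist_add_rank_fun[OF \<Phi> T(1), of w] T(2) \<Phi>\<^sub>2(3) by (simp add: \<Phi>\<^sub>1_def)
      also have "\<dots> \<le> r"
        using mult_right_mono[OF c(2) less_imp_le[OF r(1)]] by linarith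
      finally show ?thesis by (simp add: norm_minus_commute)
    qed
    have le_k: "norm (\<Phi>\<^sub>2 q) \<le> k" if "q \<in> Pi_set \<theta>" for q
      using norm_le_num_radius[OF bdd[OF \<Phi>\<^sub>2(1)] that] by (simp add: k_def)
    have "k \<le> 1 + r"
      using norm_triangle_sub[of "\<Phi>\<^sub>2 z" "\<Phi> z"] close[OF z(1)] z(2)
        norm_le_num_radius[OF bdd[OF \<Phi>] z(1)] v by linarith
    moreover have "norm (\<Phi> q) \<le> k + r" if "q \<in> Pi_set \<theta>" for q
      using norm_triangle_sub[of "\<Phi> q" "\<Phi>\<^sub>2 q"] close[OF that] le_k[OF that]
        norm_minus_commute[of "\<Phi> q" "\<Phi>\<^sub>2 q"] by linarith
    then have "1 \<le> k + r"
      using num_radius_le[of \<Phi> "k + r"] v by simp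
    ultimately have k: "\<bar>1 - k\<bar> \<le> r" "0 < k"
      using r by auto
    define \<Psi> where "\<Psi> = (\<lambda>q. (1 / k) *\<^sub>R \<Phi>\<^sub>2 q)"
    have \<Psi>: "\<Psi> \<in> Z"
      using Z_scaleR[OF \<Phi>\<^sub>2(1)] by (simp add: \<Psi>_def)
    have \<Psi>z: "norm (\<Psi> z) = 1"
      using z(2) k(2) by (simp add: \<Psi>_def)
    have "num_radius \<theta> \<Psi> \<le> 1"
      using le_k k(2) by (intro num_radius_le) (simp add: \<Psi>_def)
    then have "num_radius \<theta> \<Psi> = 1"
      using norm_le_num_radius[OF bdd[OF \<Psi>] z(1)] \<Psi>z by simp
    moreover have "norm (\<Psi> q - \<Phi> q) \<le> 2 * r" if "q \<in> Pi_set \<theta>" for q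
    proof -
      have "\<Psi> q - \<Phi>\<^sub>2 q = (1 / k - 1) *\<^sub>R \<Phi>\<^sub>2 q"
        by (simp add: \<Psi>_def scaleR_diff_left)
      then have "norm (\<Psi> q - \<Phi>\<^sub>2 q) \<le> \<bar>1 / k - 1\<bar> * k"
        using le_k[OF that] by (simp add: mult_left_mono)
      also have "\<dots> = \<bar>(1 / k - 1) * k\<bar>"
        using k(2) by (simp add: abs_mult)
      also have "(1 / k - 1) * k = 1 - k"
        using k(2) by (simp add: field_simps)
      finally have "norm (\<Psi> q - \<Phi>\<^sub>2 q) \<le> r"
        using k(1) by linarith
      then show ?thesis
        using close[OF that] norm_triangle_ineq[of "\<Psi> q - \<Phi>\<^sub>2 q" "\<Phi>\<^sub>2 q - \<Phi> q"] by simp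
    qed
    then have "num_radius \<theta> (\<lambda>p. \<Psi> p - \<Phi> p) < \<epsilon>"
      using num_radius_le[of "\<lambda>p. \<Psi> p - \<Phi> p" "2 * r"] r(3) by simp
    ultimately show "\<exists>\<Psi>\<in>Z. \<exists>z\<in>Pi_set \<theta>. num_radius \<theta> \<Psi> = 1 \<and> norm (\<Psi> z) = 1 \<and>
        sum_norm (z - p) < \<epsilon> \<and> num_radius \<theta> (\<lambda>p. \<Psi> p - \<Phi> p) < \<epsilon>"
      using \<Psi> z \<Psi>z by blast
  qed
qed

end

theorem corollary1:
  fixes \<theta> :: "'x::banach \<times> ('y::banach \<Rightarrow>\<^sub>L real) \<Rightarrow> real"
    and Z :: "('x \<times> ('y \<Rightarrow>\<^sub>L real) \<Rightarrow> 'w::banach) set"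
    and N :: "('x \<times> ('y \<Rightarrow>\<^sub>L real) \<Rightarrow> 'w) \<Rightarrow> real"
  assumes X_nonzero: "\<exists>x::'x. x \<noteq> 0"
    and Y_nonzero: "\<exists>y::'y. y \<noteq> 0"
    and W_nonzero: "\<exists>w::'w. w \<noteq> 0"
    and X_uniformly_convex: "uniformly_convex TYPE('x)"
    and Y_uniformly_smooth: "uniformly_smooth TYPE('y)"
    and theta_nonzero: "\<exists>p \<in> sphere 0 1 \<times> sphere 0 1. \<theta> p \<noteq> 0"
    and theta_uniformly_continuous: "uniformly_continuous_on (sphere 0 1 \<times> sphere 0 1) \<theta>"
    and theta_odd: "\<And>x y. x \<in> sphere 0 1 \<Longrightarrow> y \<in> sphere 0 1 \<Longrightarrow>
          \<theta> (- x, y) = - \<theta> (x, y) \<and> \<theta> (x, - y) = - \<theta> (x, y)"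
    and Pi_nonempty: "Pi_set \<theta> \<noteq> {}"
    and Z_banach: "banach_function_space Z N"
    and Z_subset: "Z \<subseteq> Cbe \<theta>"
    and N_ge_sup_norm: "\<And>\<Phi>. \<Phi> \<in> Z \<Longrightarrow> num_radius \<theta> \<Phi> \<le> N \<Phi>"
    and Z_contains_finite_rank: "\<And>T w. finite_rank T \<Longrightarrow>
          rank_fun \<theta> T w \<in> Z \<and> N (rank_fun \<theta> T w) \<le> norm T * norm w"
  shows "(\<forall>\<Theta> \<in> Cbe \<theta>. \<exists>A. sigma_porous_in (norm_metric Z N) A \<and>
            {\<Phi> \<in> Z. attains_strongly \<theta> (\<lambda>p. \<Theta> p + \<Phi> p)} = Z - A) \<and>
         (\<forall>\<epsilon>>0. \<exists>\<eta>>0. \<forall>\<Phi>\<in>Z. \<forall>(x, y)\<in>Pi_set \<theta>.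
            num_radius \<theta> \<Phi> = 1 \<and> norm (\<Phi> (x, y)) > 1 - \<eta> \<longrightarrow>
            (\<exists>\<Psi>\<in>Z. \<exists>(z, t)\<in>Pi_set \<theta>.
               num_radius \<theta> \<Psi> = 1 \<and> norm (\<Psi> (z, t)) = 1 \<and>
               norm (z - x) + norm (t - y) < \<epsilon> \<and>
               num_radius \<theta> (\<lambda>p. \<Psi> p - \<Phi> p) < \<epsilon>))"
proof -
  interpret finite_rank_function_space \<theta> Z N
    by unfold_locales (fact assms)+
  show ?thesis
  proof (intro conjI ballI allI impI)
    fix \<Theta> :: "'x \<times> ('y \<Rightarrow>\<^sub>L real) \<Rightarrow> 'w" assume \<Theta>: "\<Theta> \<in> Cbe \<theta>"
    show "\<exists>A. sigma_porous_in (norm_metric Z N) A \<and>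
            {\<Phi> \<in> Z. attains_strongly \<theta> (\<lambda>p. \<Theta> p + \<Phi> p)} = Z - A"
      using sigma_porous_not_attains_strongly[OF \<Theta>] by (intro exI conjI) auto
  next
    fix \<epsilon> :: real assume "0 < \<epsilon>"
    from bishop_phelps_bollobas[OF this] obtain \<eta> where \<eta>: "0 < \<eta>" and
      *: "\<And>\<Phi> p. \<lbrakk>\<Phi> \<in> Z; p \<in> Pi_set \<theta>; num_radius \<theta> \<Phi> = 1; norm (\<Phi> p) > 1 - \<eta>\<rbrakk> \<Longrightarrow>
        \<exists>\<Psi>\<in>Z. \<exists>z\<in>Pi_set \<theta>. num_radius \<theta> \<Psi> = 1 \<and> norm (\<Psi> z) = 1 \<and> sum_norm (z - p) < \<epsilon> \<and>
          num_radius \<theta> (\<lambda>p. \<Psi> p - \<Phi> p) < \<epsilon>"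
      by blast
    show "\<exists>\<eta>>0. \<forall>\<Phi>\<in>Z. \<forall>(x, y)\<in>Pi_set \<theta>.
            num_radius \<theta> \<Phi> = 1 \<and> norm (\<Phi> (x, y)) > 1 - \<eta> \<longrightarrow>
            (\<exists>\<Psi>\<in>Z. \<exists>(z, t)\<in>Pi_set \<theta>.
               num_radius \<theta> \<Psi> = 1 \<and> norm (\<Psi> (z, t)) = 1 \<and>
               norm (z - x) + norm (t - y) < \<epsilon> \<and>
               num_radius \<theta> (\<lambda>p. \<Psi> p - \<Phi> p) < \<epsilon>)"
    proof (intro exI[of _ \<eta>] conjI ballI, fact)
      fix \<Phi> p assume "\<Phi> \<in> Z" "p \<in> Pi_set \<theta>"
      then show "case p of (x, y) \<Rightarrow> num_radius \<theta> \<Phi> = 1 \<and> norm (\<Phi> (x, y)) > 1 - \<eta> \<longrightarrow>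
            (\<exists>\<Psi>\<in>Z. \<exists>(z, t)\<in>Pi_set \<theta>.
               num_radius \<theta> \<Psi> = 1 \<and> norm (\<Psi> (z, t)) = 1 \<and>
               norm (z - x) + norm (t - y) < \<epsilon> \<and>
               num_radius \<theta> (\<lambda>p. \<Psi> p - \<Phi> p) < \<epsilon>)"
        using *[of \<Phi> p] by (cases p) (simp add: sum_norm_def case_prod_beta)
    qed
  qed
qed

end
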